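(* Assume that $0\le \tau_{ij}(t)\le\tau$ for all $t\ge 0$ and all $i,j=1,\dots,N$, and that the digraph $\mathcal G$ is strongly connected, with depth $\gamma$. Let $\tilde\psi:\mathbb R\to\mathbb R$ be a positive, bounded, continuous function such that $$\int_0^{+\infty}\Bigl(\min_{r\in[0,t]}\tilde\psi(r)\Bigr)^{\gamma}dt=+\infty .$$ Assume that the weight functions $\alpha_{ij}:[0,+\infty)\to[0,1]$ are Lebesgue measurable and satisfy the Persistence Excitation Condition: there exist constants $T>0$ and $\tilde\alpha>0$ such that $$\int_t^{t+T}\alpha_{ij}(s)\,ds\ge\tilde\alpha\qquad\text{for all } t\ge 0 \text{ and all } i,j \text{ with } \chi_{ij}=1 .$$ Let $x_i^0,v_i^0:[-\tau,0]\to\mathbb R^d$ be continuous functions for each $i=1,\dots,N$. Then, for every solution $\{(x_i,v_i)\}_{i=1,\dots,N}$ of $$\frac{d}{dt}x_i(t)=v_i(t),\qquad \frac{d}{dt}v_i(t)=\sum_{j:\,j\ne i}\chi_{ij}\,\alpha_{ij}(t)\,c_{ij}(t)\,\bigl(v_j(t-\tau_{ij}(t))-v_i(t)\bigr),\quad t>0,\ i=1,\dots,N,$$ with $c_{ij}(t)=\frac{1}{N-1}\tilde\psi(|x_i(t)-x_j(t-\tau_{ij}(t))|)$ and initial conditions $x_i(s)=x_i^0(s)$, $v_i(s)=v_i^0(s)$ for $s\in[-\tau,0]$, $i=1,\dots,N$, there exists a constant $d^*>0$ such that $$\sup_{t\ge-\tau}d_X(t)\le d^*,$$ and there exists a constant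 $\mu>0$ such that $$d_V(t)\le\Bigl(\max_{i,j=1,\dots,N}\ \max_{r,s\in[-\tau,0]}|v_i(r)-v_j(s)|\Bigr)\,e^{-\mu(t-\gamma(T+\tau)-\tau)}\qquad\text{for all } t\ge 0,$$ where $d_X(t):=\max_{i,j}|x_i(t)-x_j(t)|$ and $d_V(t):=\max_{i,j}|v_i(t)-v_j(t)|$ for $t\ge-\tau$.
   Context: $N\ge 2$ and $d\ge1$ are integers, $|\cdot|$ is the Euclidean norm on $\mathbb R^d$, and $\tau>0$ is a constant. The delay functions $\tau_{ij}:[0,+\infty)\to[0,+\infty)$ are continuous. Graph: $\mathcal G=(\mathcal V,\mathcal E)$ is a digraph with vertex set $\mathcal V=\{1,\dots,N\}$ and no self-loops; $\chi_{ij}=1$ if $(i,j)\in\mathcal E$ (agent $j$ transmits information to agent $i$) and $\chi_{ij}=0$ otherwise. A path from $i_0$ to $i_p$ is a finite sequence $i_0,\dots,i_p$ of distinct vertices such that each successive pair is an arc of $\mathcal G$; $p$ is its length. $\mathrm{dist}(i,j)$ is the length of the shortest path from $i$ to $j$. $\mathcal G$ is strongly connected if each vertex is reachable by a path from any other vertex. The depth of $\mathcal G$ is $\gamma:=\max_{i,j=1,\dots,N}\mathrm{dist}(i,j)$. A solution is a family of continuous functions $x_i,v_i:[-\tau,+\infty)\to\mathbb R^d$, locally absolutely continuous on $[0,+\infty)$, satisfying the system for almost every $t>0$ and the initial conditions on $[-\tau,0]$. "Positive" means strictly positive. *)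

theory Defs
  imports "HOL-Analysis.Analysis" "Graph_Theory.Graph_Theory"
begin

text \<open>
  An arc \<open>(i, j)\<close> of the communication graph means that agent \<open>j\<close> transmits information to
  agent \<open>i\<close>.  A \<open>vpath\<close> is a nonempty walk with pairwise distinct vertices and \<open>vwalk_length\<close>
  counts its arcs; the one-vertex path has length 0, so every vertex is at distance 0 from itself.
\<close>

definition path_lengths :: "'a pair_pre_digraph \<Rightarrow> 'a \<Rightarrow> 'a \<Rightarrow> nat set" where
  "path_lengths G i j =
     {vwalk_length p | p. vpath p (with_proj G) \<and> hd p = i \<and> last p = j}"

text \<open>Meaningful only if \<open>j\<close> is reachable from \<open>i\<close>: \<open>Inf {} = 0\<close> on \<open>nat\<close>.\<close>
definition graph_dist :: "'a pair_pre_digraph \<Rightarrow> 'a \<Rightarrow> 'a \<Rightarrow> nat" where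
  "graph_dist G i j = Inf (path_lengths G i j)"

definition graph_depth :: "'a pair_pre_digraph \<Rightarrow> nat" where
  "graph_depth G = (MAX (i, j) \<in> pverts G \<times> pverts G. graph_dist G i j)"

definition adj_coeff :: "'a pair_pre_digraph \<Rightarrow> 'a \<Rightarrow> 'a \<Rightarrow> real" where
  "adj_coeff G i j = (if (i, j) \<in> parcs G then 1 else 0)"

text \<open>
  Absolute continuity of functions (the library's \<open>absolutely_continuous\<close> is the relation between
  measures).  A finite set \<open>P\<close> of pairs \<open>(u, v)\<close> encodes a finite family of pairwise
  disjoint open intervals with end points in \<open>[a, b]\<close>.
\<close>
definition abs_continuous_on_interval ::
    "real \<Rightarrow> real \<Rightarrow> (real \<Rightarrow> 'b::real_normed_vector) \<Rightarrow> bool" where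
  "abs_continuous_on_interval a b f \<longleftrightarrow>
     (\<forall>\<epsilon>>0. \<exists>\<delta>>0. \<forall>P. finite P \<longrightarrow>
        (\<forall>(u, v)\<in>P. a \<le> u \<and> u < v \<and> v \<le> b) \<longrightarrow>
        disjoint_family_on (\<lambda>(u, v). {u<..<v}) P \<longrightarrow>
        (\<Sum>(u, v)\<in>P. v - u) < \<delta> \<longrightarrow>
        (\<Sum>(u, v)\<in>P. norm (f v - f u)) < \<epsilon>)"

definition locally_abs_continuous_on ::
    "real set \<Rightarrow> (real \<Rightarrow> 'b::real_normed_vector) \<Rightarrow> bool" where
  "locally_abs_continuous_on S f \<longleftrightarrow>
     (\<forall>a b. {a..b} \<subseteq> S \<longrightarrow> abs_continuous_on_interval a b f)"

definition comm_weight ::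
    "nat \<Rightarrow> (real \<Rightarrow> real) \<Rightarrow> (nat \<Rightarrow> nat \<Rightarrow> real \<Rightarrow> real) \<Rightarrow> (nat \<Rightarrow> real \<Rightarrow> real ^ 'd)
       \<Rightarrow> nat \<Rightarrow> nat \<Rightarrow> real \<Rightarrow> real" where
  "comm_weight N \<psi> \<tau>d x i j t =
     1 / (real N - 1) * \<psi> (norm (x i t - x j (t - \<tau>d i j t)))"

text \<open>
  Functions of time are total in HOL; only the values on \<open>[-\<tau>, \<infinity>)\<close> (for \<open>x\<close>, \<open>v\<close>),
  on \<open>[0, \<infinity>)\<close> (for the delays \<open>\<tau>d\<close> and weights \<open>\<alpha>\<close>) and on \<open>[-\<tau>, 0]\<close>
  (for the initial data \<open>x0\<close>, \<open>v0\<close>) and of agents in \<open>{1..N}\<close> are relevant.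
\<close>
definition is_solution ::
    "nat \<Rightarrow> nat pair_pre_digraph \<Rightarrow> real \<Rightarrow> (real \<Rightarrow> real) \<Rightarrow> (nat \<Rightarrow> nat \<Rightarrow> real \<Rightarrow> real)
       \<Rightarrow> (nat \<Rightarrow> nat \<Rightarrow> real \<Rightarrow> real) \<Rightarrow> (nat \<Rightarrow> real \<Rightarrow> real ^ 'd) \<Rightarrow> (nat \<Rightarrow> real \<Rightarrow> real ^ 'd)
       \<Rightarrow> (nat \<Rightarrow> real \<Rightarrow> real ^ 'd) \<Rightarrow> (nat \<Rightarrow> real \<Rightarrow> real ^ 'd) \<Rightarrow> bool" where
  "is_solution N G \<tau> \<psi> \<tau>d \<alpha> x0 v0 x v \<longleftrightarrow>
     (\<forall>i\<in>{1..N}.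
        continuous_on {-\<tau>..} (x i) \<and> continuous_on {-\<tau>..} (v i) \<and>
        locally_abs_continuous_on {0..} (x i) \<and> locally_abs_continuous_on {0..} (v i) \<and>
        (AE t in lebesgue. t > 0 \<longrightarrow>
           (x i has_vector_derivative v i t) (at t) \<and>
           (v i has_vector_derivative
              (\<Sum>j\<in>{1..N} - {i}.
                 (adj_coeff G i j * \<alpha> i j t * comm_weight N \<psi> \<tau>d x i j t) *\<^sub>R
                   (v j (t - \<tau>d i j t) - v i t))) (at t)) \<and>
        (\<forall>s\<in>{-\<tau>..0}. x i s = x0 i s \<and> v i s = v0 i s))"

definition agent_diam :: "nat \<Rightarrow> (nat \<Rightarrow> real \<Rightarrow> real ^ 'd) \<Rightarrow> real \<Rightarrow> real" where
  "agent_diam N z t = (MAX (i, j) \<in> {1..N} \<times> {1..N}. norm (z i t - z j t))"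

text \<open>For continuous \<open>z\<close> the supremum over the compact square is attained, i.e. is a maximum.\<close>
definition init_diam :: "nat \<Rightarrow> real \<Rightarrow> (nat \<Rightarrow> real \<Rightarrow> real ^ 'd) \<Rightarrow> real" where
  "init_diam N \<tau> z =
     (MAX (i, j) \<in> {1..N} \<times> {1..N}.
        SUP (r, s) \<in> {-\<tau>..0} \<times> {-\<tau>..0}. norm (z i r - z j s))"

end

theory Submission
  imports Defs
begin

text \<open>
  Along a fixed unit vector the velocities satisfy a scalar delayed averaging system, for which the
  range over a time window of length \<open>\<tau>\<close> never grows. Over a period
  \<open>h = \<gamma> (T + \<tau>) + \<tau>\<close>, one agent lies at least half the diameter away from one end of the range,
  and persistence of excitation propagates this gap along shortest paths to all agents.
  Hence the velocity diameter shrinks by a factor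
  \<open>1 - c m\<^sup>\<gamma>\<close> with \<open>m\<close> the minimum of the influence function over the distances reached so far,
  while the spatial diameter grows by at most \<open>h\<close> times the velocity diameter. Divergence of the
  integral then forces the spatial diameter to stay bounded, after which the factors are bounded
  away from 1.
\<close>

subsection \<open>Absolutely continuous functions\<close>

text \<open>The maximum principle behind the argument is scalar, hence the fixed unit vectors; all
  constants are independent of the vector, so passing to the supremum over unit vectors costs
  nothing. Derivatives exist only almost everywhere: increments are recovered from absolute
  continuity through the gauge integral, where integrability of the derivative is part of the
  conclusion. In the period \<open>h\<close>, each of the at most \<open>\<gamma>\<close> arcs takes
  a time \<open>T + \<tau>\<close>, and the last \<open>\<tau>\<close> provides a full window with
  contracted diameter, from which the next period can start. Each arc costs one factor proportional
  to the minimum of the influence function, hence the power \<open>\<gamma>\<close> in the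
  divergence hypothesis. The apparent circle (contraction needs bounded distances, which need
  decaying velocities) is broken because the distances in a period are already controlled by the
  velocity diameter at its beginning. Delayed distances exceed current ones by at most a fixed lag,
  absorbed in the starting value of the distance bound.\<close>

lemma sum_lengths_less_emeasure:
  fixes f :: "real \<Rightarrow> 'b::real_normed_vector"
  assumes P: "finite P" "\<And>u v. (u, v) \<in> P \<Longrightarrow> u < v \<and> {u..v} \<subseteq> U"
    and dis: "disjoint_family_on (\<lambda>(u, v). {u<..<v}) P"
    and U: "U \<in> sets lebesgue" "emeasure lebesgue U < ennreal \<delta>" and "\<delta> > 0"
  shows "(\<Sum>(u, v)\<in>P. v - u) < \<delta>"
proof -
  have "ennreal (\<Sum>(u, v)\<in>P. v - u) = (\<Sum>p\<in>P. ennreal (snd p - fst p))"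
    using P by (subst sum_ennreal[symmetric]) (auto simp: case_prod_beta less_imp_le)
  also have "\<dots> = (\<Sum>p\<in>P. emeasure lebesgue (case p of (u, v) \<Rightarrow> {u<..<v}))"
    using P by (intro sum.cong) (auto simp: less_imp_le)
  also have "\<dots> = emeasure lebesgue (\<Union>p\<in>P. case p of (u, v) \<Rightarrow> {u<..<v})"
    using P dis by (intro sum_emeasure) auto
  also have "\<dots> \<le> emeasure lebesgue U"
    using P(2) U(1) by (intro emeasure_mono) fastforce+
  also have "\<dots> < ennreal \<delta>" by (rule U)
  finally show ?thesis
    using ennreal_less_iff[of "\<Sum>(u, v)\<in>P. v - u" \<delta>] P
    by (simp add: sum_nonneg case_prod_beta less_imp_le)
qed

text \<open>The exceptional null set is covered by an open set of small measure, on which absolute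
  continuity controls the increments of \<open>f\<close>; elsewhere the gauge comes from
  differentiability at the tag.\<close>
lemma abs_continuous_has_integral_derivative:
  fixes f F :: "real \<Rightarrow> 'b::real_normed_vector"
  assumes "a \<le> b" and ac: "abs_continuous_on_interval a b f"
    and der: "AE t in lebesgue. a < t \<and> t < b \<longrightarrow> (f has_vector_derivative F t) (at t)"
  shows "(F has_integral (f b - f a)) {a..b}"
proof -
  obtain E0 where E0: "{t. \<not> (a < t \<and> t < b \<longrightarrow> (f has_vector_derivative F t) (at t))} \<subseteq> E0"
      "E0 \<in> null_sets lebesgue"
    using der by (auto simp: eventually_ae_filter)
  \<comment> \<open>The endpoints join the exceptional set because differentiability is given only
    in the open interval.\<close>
  define E where "E = E0 \<union> {a, b}"
  have Enull: "E \<in> null_sets lebesgue" unfolding E_def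
    using E0(2) by (intro null_sets.Un) (auto simp flip: negligible_iff_null_sets)
  have derE: "(f has_vector_derivative F x) (at x)" if "x \<in> {a..b}" "x \<notin> E" for x
    using E0(1) that unfolding E_def by force
  \<comment> \<open>The value 0 on the null set leaves the integral unchanged and reduces each
    summand with tag in \<open>E\<close> to minus an increment of \<open>f\<close>.\<close>
  define F' where "F' x = (if x \<in> E then 0 else F x)" for x
  have "(F' has_integral (f b - f a)) {a..b}"
    unfolding has_integral_real
  proof (intro allI impI)
    fix e :: real assume "e > 0"
    define \<epsilon> where "\<epsilon> = e / 2 / (b - a + 1)"
    have "\<epsilon> > 0" using \<open>e > 0\<close> \<open>a \<le> b\<close> by (simp add: \<epsilon>_def)
    have \<epsilon>_small: "\<epsilon> * (b - a) \<le> e / 2"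
      using \<open>e > 0\<close> \<open>a \<le> b\<close> unfolding \<epsilon>_def by (simp add: field_simps)
    obtain \<delta> where "\<delta> > 0" and \<delta>: "\<forall>P. finite P \<longrightarrow> (\<forall>(u, v)\<in>P. a \<le> u \<and> u < v \<and> v \<le> b) \<longrightarrow>
        disjoint_family_on (\<lambda>(u, v). {u<..<v}) P \<longrightarrow> (\<Sum>(u, v)\<in>P. v - u) < \<delta> \<longrightarrow>
        (\<Sum>(u, v)\<in>P. norm (f v - f u)) < e / 2"
      using ac[unfolded abs_continuous_on_interval_def, rule_format, OF half_gt_zero[OF \<open>e > 0\<close>]] by blast
    obtain U where U: "open U" "E \<subseteq> U" "emeasure lebesgue (U - E) < ennreal \<delta>"
      using sets_lebesgue_outer_open[of E \<delta>] Enull \<open>\<delta> > 0\<close> by (metis null_setsD2)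
    have U_sets: "U \<in> sets lebesgue" using U(1) by auto
    have U_less: "emeasure lebesgue U < ennreal \<delta>"
      using U(3) Enull U_sets by (simp add: emeasure_Diff_null_set)
    have "\<exists>d>0. \<forall>y. \<bar>y - x\<bar> < d \<longrightarrow> norm (f y - f x - (y - x) *\<^sub>R F x) \<le> \<epsilon> * \<bar>y - x\<bar>"
      if "x \<in> {a..b} - E" for x
      using derE[of x] that \<open>\<epsilon> > 0\<close>
      unfolding has_vector_derivative_def has_derivative_at_alt by (auto simp: real_norm_def)
    then obtain d where d: "\<And>x. x \<in> {a..b} - E \<Longrightarrow> d x > 0"
        "\<And>x y. x \<in> {a..b} - E \<Longrightarrow> \<bar>y - x\<bar> < d x \<Longrightarrow> norm (f y - f x - (y - x) *\<^sub>R F x) \<le> \<epsilon> * \<bar>y - x\<bar>"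
      by metis
    define g where "g x = (if x \<in> E then U else if x \<in> {a..b} then ball x (d x) else UNIV)" for x
    have "gauge g"
      using U d(1) by (auto simp: gauge_def g_def)
    moreover have "norm ((\<Sum>(x, k)\<in>\<D>. measure lborel k *\<^sub>R F' x) - (f b - f a)) < e"
      if D: "\<D> tagged_division_of {a..b}" "g fine \<D>" for \<D>
    proof -
      have fin: "finite \<D>" using D by auto
      have iv: "\<exists>u v. k = {u..v} \<and> u \<le> x \<and> x \<le> v \<and> a \<le> u \<and> v \<le> b \<and> Inf k = u \<and> Sup k = v
          \<and> measure lborel k = v - u \<and> interior k = {u<..<v}" if xk: "(x, k) \<in> \<D>" for x k
      proof -
        obtain u v where "k = cbox u v" using tagged_division_ofD(4)[OF D(1) xk] by auto
        moreover have "x \<in> k" "k \<subseteq> {a..b}" using tagged_division_ofD(2,3)[OF D(1) xk] by auto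
        ultimately show ?thesis by (intro exI[of _ u] exI[of _ v]) auto
      qed
      define D1 D2 where "D1 = {p \<in> \<D>. fst p \<in> E}" and "D2 = {p \<in> \<D>. fst p \<notin> E}"
      let ?t = "\<lambda>(x, k). measure lborel k *\<^sub>R F' x - (f (Sup k) - f (Inf k))"
      have "(\<Sum>(x, k)\<in>\<D>. measure lborel k *\<^sub>R F' x) - (f b - f a) = sum ?t \<D>"
        by (subst additive_tagged_division_1[OF \<open>a \<le> b\<close> D(1), symmetric])
           (simp add: sum_subtractf case_prod_beta)
      also have "\<dots> = sum ?t D1 + sum ?t D2"
        using fin unfolding D1_def D2_def
        by (subst sum.union_disjoint[symmetric]) (auto intro!: sum.cong)
      finally have split: "(\<Sum>(x, k)\<in>\<D>. measure lborel k *\<^sub>R F' x) - (f b - f a) = sum ?t D1 + sum ?t D2" .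
      have "norm (sum ?t D2) \<le> (\<Sum>(x, k)\<in>D2. \<epsilon> * (Sup k - Inf k))"
      proof (rule sum_norm_le, clarify)
        fix x k assume xk: "(x, k) \<in> D2"
        then have xk': "(x, k) \<in> \<D>" "x \<notin> E" by (auto simp: D2_def)
        obtain u v where k: "k = {u..v}" "u \<le> x" "x \<le> v" "a \<le> u" "v \<le> b" "Inf k = u" "Sup k = v"
            "measure lborel k = v - u" using iv[OF xk'(1)] by blast
        have x: "x \<in> {a..b} - E" using k xk' by auto
        have "k \<subseteq> g x" using D(2) xk' by (auto simp: fine_def)
        then have "k \<subseteq> ball x (d x)" using x by (simp add: g_def)
        moreover have "u \<in> k" "v \<in> k" using k by auto
        ultimately have "u \<in> ball x (d x)" "v \<in> ball x (d x)" by blast+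
        then have "\<bar>u - x\<bar> < d x" "\<bar>v - x\<bar> < d x" by (auto simp: dist_real_def)
        from d(2)[OF x this(1)] d(2)[OF x this(2)]
        have "norm (f u - f x - (u - x) *\<^sub>R F x) \<le> \<epsilon> * (x - u)"
          "norm (f v - f x - (v - x) *\<^sub>R F x) \<le> \<epsilon> * (v - x)" using k by auto
        moreover have eq: "measure lborel k *\<^sub>R F' x - (f (Sup k) - f (Inf k)) =
          (f u - f x - (u - x) *\<^sub>R F x) - (f v - f x - (v - x) *\<^sub>R F x)"
          unfolding k(6-8) using xk' by (simp add: F'_def algebra_simps)
        ultimately have "norm (measure lborel k *\<^sub>R F' x - (f (Sup k) - f (Inf k)))
            \<le> \<epsilon> * (x - u) + \<epsilon> * (v - x)"
          unfolding eq using norm_triangle_ineq4 by (meson add_mono order_trans)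
        also have "\<dots> = \<epsilon> * (Sup k - Inf k)" unfolding k(6,7) by (simp add: algebra_simps)
        finally show "norm (measure lborel k *\<^sub>R F' x - (f (Sup k) - f (Inf k))) \<le> \<epsilon> * (Sup k - Inf k)" .
      qed
      also have "\<dots> \<le> (\<Sum>(x, k)\<in>\<D>. \<epsilon> * (Sup k - Inf k))"
        using fin iv \<open>\<epsilon> > 0\<close> by (intro sum_mono2) (force simp: D2_def)+
      also have "\<dots> = \<epsilon> * (b - a)"
        using additive_tagged_division_1[OF \<open>a \<le> b\<close> D(1), of "\<lambda>x. x"]
        by (simp add: case_prod_beta flip: sum_distrib_left)
      finally have 2: "norm (sum ?t D2) \<le> e / 2" using \<epsilon>_small by simp
      \<comment> \<open>Degenerate intervals are removed: absolute continuity asks for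
        \<open>u < v\<close>, and distinct members of the division have distinct endpoint pairs only
        if their interiors are nonempty. The increments lost in this way are zero.\<close>
      define D3 where "D3 = {p \<in> D1. Inf (snd p) < Sup (snd p)}"
      define P where "P = (\<lambda>p. (Inf (snd p), Sup (snd p))) ` D3"
      have D3D: "(x, k) \<in> \<D> \<and> x \<in> E \<and> Inf k < Sup k" if "(x, k) \<in> D3" for x k
        using that by (auto simp: D3_def D1_def)
      have finD3: "finite D3" using fin by (auto simp: D3_def D1_def)
      have disj: "{Inf k<..<Sup k} \<inter> {Inf k'<..<Sup k'} = {}"
        if "(x, k) \<in> D3" "(x', k') \<in> D3" "(x, k) \<noteq> (x', k')" for x k x' k'
        using tagged_division_ofD(5)[OF D(1), of x k x' k'] iv[of x k] iv[of x' k'] D3D that by fastforce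
      have inj: "inj_on (\<lambda>p. (Inf (snd p), Sup (snd p))) D3"
      proof (rule inj_onI, clarify)
        fix x k x' k' assume *: "(x, k) \<in> D3" "(x', k') \<in> D3"
          "Inf (snd (x, k)) = Inf (snd (x', k'))" "Sup (snd (x, k)) = Sup (snd (x', k'))"
        then have "(Inf k + Sup k) / 2 \<in> {Inf k<..<Sup k} \<inter> {Inf k'<..<Sup k'}"
          using D3D[OF *(1)] by auto
        then show "x = x' \<and> k = k'" using disj[OF *(1,2)] by blast
      qed
      have "(\<Sum>(u, v)\<in>P. norm (f v - f u)) < e / 2"
      proof (rule \<delta>[rule_format])
        show "finite P" using finD3 by (simp add: P_def)
        show "case p of (u, v) \<Rightarrow> a \<le> u \<and> u < v \<and> v \<le> b" if "p \<in> P" for p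
          using that D3D iv by (fastforce simp: P_def)
        show disP: "disjoint_family_on (\<lambda>(u, v). {u<..<v}) P"
          unfolding disjoint_family_on_def P_def using disj by fastforce
        show "(\<Sum>(u, v)\<in>P. v - u) < \<delta>"
        proof (rule sum_lengths_less_emeasure[OF \<open>finite P\<close> _ disP U_sets U_less \<open>\<delta> > 0\<close>])
          fix u v assume "(u, v) \<in> P"
          then obtain x k where "(x, k) \<in> D3" "u = Inf k" "v = Sup k" by (auto simp: P_def)
          moreover from this have "k \<subseteq> g x" "x \<in> E" using D3D[of x k] D(2) by (auto simp: fine_def)
          ultimately show "u < v \<and> {u..v} \<subseteq> U"
            using D3D[of x k] iv[of x k] by (auto simp: g_def)
        qed
      qed
      also have "(\<Sum>(u, v)\<in>P. norm (f v - f u)) = (\<Sum>(x, k)\<in>D3. norm (f (Sup k) - f (Inf k)))"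
        unfolding P_def by (subst sum.reindex[OF inj]) (simp add: case_prod_beta)
      also have "\<dots> = (\<Sum>(x, k)\<in>D1. norm (f (Sup k) - f (Inf k)))"
      proof (rule sum.mono_neutral_left)
        show "finite D1" using fin by (simp add: D1_def)
        have "norm (f (Sup k) - f (Inf k)) = 0" if "(x, k) \<in> D1 - D3" for x k
        proof -
          have "Inf k \<le> Sup k" using iv[of x k] that by (force simp: D1_def)
          then have "Inf k = Sup k" using that by (simp add: D3_def)
          then show ?thesis by simp
        qed
        then show "\<forall>p\<in>D1 - D3. (case p of (x, k) \<Rightarrow> norm (f (Sup k) - f (Inf k))) = 0" by auto
      qed (auto simp: D3_def)
      finally have "(\<Sum>(x, k)\<in>D1. norm (f (Sup k) - f (Inf k))) < e / 2" .
      moreover have "norm (sum ?t D1) \<le> (\<Sum>(x, k)\<in>D1. norm (f (Sup k) - f (Inf k)))"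
        by (rule sum_norm_le) (auto simp: D1_def F'_def norm_minus_commute)
      ultimately have 1: "norm (sum ?t D1) < e / 2" by simp
      have "norm (sum ?t D1 + sum ?t D2) < e / 2 + e / 2"
        by (rule le_less_trans[OF norm_triangle_ineq add_less_le_mono[OF 1 2]])
      then show ?thesis unfolding split by simp
    qed
    ultimately have "gauge g \<and> (\<forall>\<D>. \<D> tagged_division_of {a..b} \<and> g fine \<D> \<longrightarrow>
        norm ((\<Sum>(x, k)\<in>\<D>. measure lborel k *\<^sub>R F' x) - (f b - f a)) < e)" by simp
    then show "\<exists>\<gamma>. gauge \<gamma> \<and> (\<forall>\<D>. \<D> tagged_division_of {a..b} \<and> \<gamma> fine \<D> \<longrightarrow>
        norm ((\<Sum>(x, k)\<in>\<D>. measure lborel k *\<^sub>R F' x) - (f b - f a)) < e)" by (rule exI[where x = g])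
  qed
  moreover have "negligible E" using Enull by (simp add: negligible_iff_null_sets)
  moreover have "F x = F' x" if "x \<in> {a..b} - E" for x using that by (simp add: F'_def)
  ultimately show ?thesis using has_integral_spike by blast
qed

lemma abs_continuous_on_bounded_linear:
  assumes "bounded_linear h" and "abs_continuous_on_interval a b f"
  shows "abs_continuous_on_interval a b (\<lambda>t. h (f t))"
  unfolding abs_continuous_on_interval_def
proof (intro allI impI)
  fix \<epsilon> :: real assume "\<epsilon> > 0"
  interpret h: bounded_linear h by fact
  obtain C where C: "C > 0" "\<And>x. norm (h x) \<le> norm x * C" using h.pos_bounded by blast
  obtain \<delta> where "\<delta> > 0" and \<delta>: "\<forall>P. finite P \<longrightarrow> (\<forall>(u, v)\<in>P. a \<le> u \<and> u < v \<and> v \<le> b) \<longrightarrow>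
      disjoint_family_on (\<lambda>(u, v). {u<..<v}) P \<longrightarrow> (\<Sum>(u, v)\<in>P. v - u) < \<delta> \<longrightarrow>
      (\<Sum>(u, v)\<in>P. norm (f v - f u)) < \<epsilon> / C"
    using assms(2)[unfolded abs_continuous_on_interval_def, rule_format, of "\<epsilon> / C"] \<open>\<epsilon> > 0\<close> C by auto
  have "(\<Sum>(u, v)\<in>P. norm (h (f v) - h (f u))) < \<epsilon>"
    if "finite P" "\<forall>(u, v)\<in>P. a \<le> u \<and> u < v \<and> v \<le> b"
      "disjoint_family_on (\<lambda>(u, v). {u<..<v}) P" "(\<Sum>(u, v)\<in>P. v - u) < \<delta>" for P
  proof -
    have "(\<Sum>(u, v)\<in>P. norm (h (f v) - h (f u))) \<le> (\<Sum>(u, v)\<in>P. norm (f v - f u) * C)"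
      using C(2) by (intro sum_mono) (auto simp flip: h.diff)
    also have "\<dots> = (\<Sum>(u, v)\<in>P. norm (f v - f u)) * C"
      by (simp add: sum_distrib_right case_prod_beta)
    also have "\<dots> < \<epsilon>"
      using \<delta>[rule_format, OF that(1) _ that(3,4)] that(2) C(1) by (auto simp: pos_less_divide_eq)
    finally show ?thesis .
  qed
  then show "\<exists>\<delta>>0. \<forall>P. finite P \<longrightarrow> (\<forall>(u, v)\<in>P. a \<le> u \<and> u < v \<and> v \<le> b) \<longrightarrow>
      disjoint_family_on (\<lambda>(u, v). {u<..<v}) P \<longrightarrow> (\<Sum>(u, v)\<in>P. v - u) < \<delta> \<longrightarrow>
      (\<Sum>(u, v)\<in>P. norm (h (f v) - h (f u))) < \<epsilon>"
    using \<open>\<delta> > 0\<close> by blast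
qed

lemma abs_continuous_on_diff_const:
  assumes "abs_continuous_on_interval a b f"
  shows "abs_continuous_on_interval a b (\<lambda>t. c - f t)"
  using assms by (simp add: abs_continuous_on_interval_def norm_minus_commute)

text \<open>Splitting the increment as \<open>(f v - f u) * h v + f u * (h v - h u)\<close> bounds
  it by a multiple of the increment of \<open>f\<close> plus a multiple of the length
  \<open>v - u\<close>. It is applied with \<open>h\<close> an exponential integrating
  factor.\<close>

lemma abs_continuous_on_mult_Lipschitz:
  fixes f h :: "real \<Rightarrow> real"
  assumes ac: "abs_continuous_on_interval a b f"
    and B: "\<And>t. t \<in> {a..b} \<Longrightarrow> \<bar>f t\<bar> \<le> B" and C: "\<And>t. t \<in> {a..b} \<Longrightarrow> \<bar>h t\<bar> \<le> C"
    and L: "L-lipschitz_on {a..b} h"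
  shows "abs_continuous_on_interval a b (\<lambda>t. f t * h t)"
proof (cases "a \<le> b")
  case False
  then have "P = {}" if "\<forall>(u, v)\<in>P. a \<le> u \<and> u < v \<and> v \<le> b" for P using that by force
  then show ?thesis unfolding abs_continuous_on_interval_def
    by (metis (no_types, lifting) sum.empty)
next
  case True
  have "B \<ge> 0" "C \<ge> 0" "L \<ge> 0" using B[of a] C[of a] True lipschitz_on_nonneg[OF L] by auto
  show ?thesis
    unfolding abs_continuous_on_interval_def
  proof (intro allI impI)
    fix \<epsilon> :: real assume "\<epsilon> > 0"
    \<comment> \<open>Each of the two contributions may use half of \<open>\<epsilon>\<close>; the
      added 1 keeps the denominators positive when \<open>C\<close> or \<open>B * L\<close>
      vanishes.\<close>
    define \<epsilon>1 \<delta>2 where "\<epsilon>1 = \<epsilon> / (2 * (C + 1))" and "\<delta>2 = \<epsilon> / (2 * (B * L + 1))"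
    have pos: "\<epsilon>1 > 0" "\<delta>2 > 0" unfolding \<epsilon>1_def \<delta>2_def
      using \<open>\<epsilon> > 0\<close> \<open>B \<ge> 0\<close> \<open>C \<ge> 0\<close> \<open>L \<ge> 0\<close> by (simp_all add: add_nonneg_pos)
    have small: "(C + 1) * \<epsilon>1 = \<epsilon> / 2" "(B * L + 1) * \<delta>2 = \<epsilon> / 2" unfolding \<epsilon>1_def \<delta>2_def
      using \<open>B \<ge> 0\<close> \<open>C \<ge> 0\<close> \<open>L \<ge> 0\<close> mult_nonneg_nonneg[of B L]
      by (auto simp: field_simps add_nonneg_eq_0_iff)
    obtain \<delta> where "\<delta> > 0" and \<delta>: "\<forall>P. finite P \<longrightarrow> (\<forall>(u, v)\<in>P. a \<le> u \<and> u < v \<and> v \<le> b) \<longrightarrow>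
        disjoint_family_on (\<lambda>(u, v). {u<..<v}) P \<longrightarrow> (\<Sum>(u, v)\<in>P. v - u) < \<delta> \<longrightarrow>
        (\<Sum>(u, v)\<in>P. norm (f v - f u)) < \<epsilon>1"
      using ac[unfolded abs_continuous_on_interval_def, rule_format, OF pos(1)] by blast
    have "(\<Sum>(u, v)\<in>P. norm (f v * h v - f u * h u)) < \<epsilon>"
      if P: "finite P" "\<forall>(u, v)\<in>P. a \<le> u \<and> u < v \<and> v \<le> b"
        "disjoint_family_on (\<lambda>(u, v). {u<..<v}) P" "(\<Sum>(u, v)\<in>P. v - u) < min \<delta> \<delta>2" for P
    proof -
      have "norm (f v * h v - f u * h u) \<le> (C + 1) * norm (f v - f u) + (B * L + 1) * (v - u)"
        if "(u, v) \<in> P" for u v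
      proof -
        have uv: "u \<in> {a..b}" "v \<in> {a..b}" "u < v" using P(2) that by force+
        have "\<bar>h v - h u\<bar> \<le> L * (v - u)"
          using lipschitz_onD[OF L uv(2,1)] uv(3) by (simp add: dist_real_def)
        then have "\<bar>f u\<bar> * \<bar>h v - h u\<bar> \<le> B * (L * (v - u))"
          using B[OF uv(1)] by (intro mult_mono) auto
        moreover have "\<bar>f v - f u\<bar> * \<bar>h v\<bar> \<le> \<bar>f v - f u\<bar> * (C + 1)"
          using C[OF uv(2)] by (intro mult_left_mono) auto
        moreover have "\<bar>f v * h v - f u * h u\<bar> \<le> \<bar>f v - f u\<bar> * \<bar>h v\<bar> + \<bar>f u\<bar> * \<bar>h v - h u\<bar>"
          using abs_triangle_ineq[of "(f v - f u) * h v" "f u * (h v - h u)"]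
          unfolding abs_mult[symmetric] by (simp add: algebra_simps)
        moreover have "(B * L + 1) * (v - u) = B * (L * (v - u)) + (v - u)" by (simp add: algebra_simps)
        ultimately show ?thesis using uv(3) by (simp add: mult.commute)
      qed
      then have "(\<Sum>(u, v)\<in>P. norm (f v * h v - f u * h u))
          \<le> (\<Sum>(u, v)\<in>P. (C + 1) * norm (f v - f u) + (B * L + 1) * (v - u))"
        by (intro sum_mono) auto
      also have "\<dots> = (C + 1) * (\<Sum>(u, v)\<in>P. norm (f v - f u)) + (B * L + 1) * (\<Sum>(u, v)\<in>P. v - u)"
        by (simp add: sum.distrib sum_distrib_left case_prod_beta)
      also have "\<dots> < (C + 1) * \<epsilon>1 + (B * L + 1) * \<delta>2"
        using \<delta>[rule_format, OF P(1) _ P(3)] P(2,4) \<open>B \<ge> 0\<close> \<open>C \<ge> 0\<close> \<open>L \<ge> 0\<close>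
        by (intro add_strict_mono mult_strict_left_mono) (auto simp: add_nonneg_pos)
      also have "\<dots> = \<epsilon>" using small by simp
      finally show ?thesis .
    qed
    then show "\<exists>\<delta>>0. \<forall>P. finite P \<longrightarrow> (\<forall>(u, v)\<in>P. a \<le> u \<and> u < v \<and> v \<le> b) \<longrightarrow>
        disjoint_family_on (\<lambda>(u, v). {u<..<v}) P \<longrightarrow> (\<Sum>(u, v)\<in>P. v - u) < \<delta> \<longrightarrow>
        (\<Sum>(u, v)\<in>P. norm (f v * h v - f u * h u)) < \<epsilon>"
      using \<open>\<delta> > 0\<close> pos(2) by (intro exI[of _ "min \<delta> \<delta>2"]) auto
  qed
qed

text \<open>Gronwall from below: with \<open>e t = exp (K * (t - a))\<close>, the derivative
  \<open>(g' + K * g) * e\<close> of \<open>g * e\<close> is at least \<open>h\<close>, because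
  \<open>e\<close> is at least 1 on the interval and \<open>h\<close> is nonnegative. The growth of
  \<open>e\<close> under the integral is given away, so \<open>H\<close> carries the same discount
  as \<open>g a\<close>.\<close>

lemma integrating_factor_lower_bound:
  fixes g g' h :: "real \<Rightarrow> real"
  assumes "a \<le> b" "K \<ge> 0" and ac: "abs_continuous_on_interval a b g" and cont: "continuous_on {a..b} g"
    and der: "AE t in lebesgue. a < t \<and> t < b \<longrightarrow>
      (g has_real_derivative g' t) (at t) \<and> h t \<le> g' t + K * g t"
    and h: "\<And>t. t \<in> {a..b} \<Longrightarrow> h t \<ge> 0" "(h has_integral H) {a..b}"
  shows "exp (- K * (b - a)) * (g a + H) \<le> g b"
proof -
  define e where "e t = exp (K * (t - a))" for t
  \<comment> \<open>Almost everywhere this is the derivative of \<open>g * e\<close>; the maximum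
    makes \<open>h t \<le> F t\<close> hold at every point, as the comparison of integrals
    requires.\<close>
  define F where "F t = max (h t) ((g' t + K * g t) * e t)" for t
  have "\<exists>B. \<forall>t\<in>{a..b}. \<bar>g t\<bar> \<le> B"
    using compact_imp_bounded[OF compact_continuous_image[OF cont compact_Icc]]
    by (auto simp: bounded_iff)
  then obtain B where B: "\<And>t. t \<in> {a..b} \<Longrightarrow> \<bar>g t\<bar> \<le> B" by blast
  have e_der: "(e has_real_derivative K * e t) (at t within S)" for t S
    unfolding e_def by (auto intro!: derivative_eq_intros)
  have e_bd: "\<bar>e t\<bar> \<le> e b" if "t \<in> {a..b}" for t
    using that \<open>K \<ge> 0\<close> by (auto simp: e_def mult_left_mono)
  have lip: "(K * e b)-lipschitz_on {a..b} e"
  proof (rule bounded_derivative_imp_lipschitz[where f' = "\<lambda>t y. y * (K * e t)"])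
    show "onorm (\<lambda>y. y * (K * e t)) \<le> K * e b" if "t \<in> {a..b}" for t
      using e_bd[OF that] \<open>K \<ge> 0\<close>
      by (intro onorm_le) (auto simp: abs_mult mult.commute mult_right_mono mult_left_mono)
  qed (use e_der \<open>K \<ge> 0\<close> in \<open>auto simp: has_field_derivative_def mult_commute_abs e_def\<close>)
  have acG: "abs_continuous_on_interval a b (\<lambda>t. g t * e t)"
    by (rule abs_continuous_on_mult_Lipschitz[OF ac B e_bd lip])
  have "AE t in lebesgue. a < t \<and> t < b \<longrightarrow> ((\<lambda>t. g t * e t) has_vector_derivative F t) (at t)"
    using der
  proof eventually_elim
    case (elim t)
    show ?case
    proof
      assume t: "a < t \<and> t < b"
      then have *: "(g has_real_derivative g' t) (at t)" "h t \<le> g' t + K * g t" "0 \<le> h t"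
        using elim h(1)[of t] by auto
      have "1 \<le> e t" using t \<open>K \<ge> 0\<close> by (simp add: e_def)
      then have "(g' t + K * g t) * 1 \<le> (g' t + K * g t) * e t" using * by (intro mult_left_mono) auto
      then have "F t = (g' t + K * g t) * e t" using * by (simp add: F_def)
      moreover have "((\<lambda>t. g t * e t) has_real_derivative (g' t + K * g t) * e t) (at t)"
        using DERIV_mult[OF *(1) e_der[of t UNIV]] by (simp add: algebra_simps)
      ultimately show "((\<lambda>t. g t * e t) has_vector_derivative F t) (at t)"
        by (simp add: has_real_derivative_iff_has_vector_derivative)
    qed
  qed
  from abs_continuous_has_integral_derivative[OF \<open>a \<le> b\<close> acG this]
  have "H \<le> g b * e b - g a * e a"
    by (rule has_integral_le[OF h(2)]) (simp add: F_def)
  then have "exp (- K * (b - a)) * (g a + H) \<le> exp (- K * (b - a)) * (g b * e b)"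
    by (simp add: e_def)
  also have "\<dots> = g b" by (simp add: e_def mult.left_commute flip: exp_add)
  finally show ?thesis .
qed

subsection \<open>Scalar averaging with delays\<close>

text \<open>Models one component of the velocities. The weights are scalars that do not depend on
  the chosen direction, so every projection is an instance with the same \<open>w\<close>,
  \<open>d\<close> and \<open>K\<close>. That the true weights depend on the positions is hidden in
  their dependence on \<open>t\<close>.\<close>

locale delayed_averaging =
  fixes I :: "'i set" and w d :: "'i \<Rightarrow> 'i \<Rightarrow> real \<Rightarrow> real" and \<tau> K :: real
    and f :: "'i \<Rightarrow> real \<Rightarrow> real"
  assumes finite_I: "finite I" and \<tau>_nonneg: "\<tau> \<ge> 0" and K_nonneg: "K \<ge> 0"
    and cont: "i \<in> I \<Longrightarrow> continuous_on {-\<tau>..} (f i)"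
    and abs_cont: "i \<in> I \<Longrightarrow> locally_abs_continuous_on {0..} (f i)"
    and deriv: "i \<in> I \<Longrightarrow> AE t in lebesgue. t > 0 \<longrightarrow>
      (f i has_real_derivative (\<Sum>j\<in>I - {i}. w i j t * (f j (t - d i j t) - f i t))) (at t)"
    and weight_nonneg: "i \<in> I \<Longrightarrow> j \<in> I \<Longrightarrow> t \<ge> 0 \<Longrightarrow> w i j t \<ge> 0"
    and weight_sum: "i \<in> I \<Longrightarrow> t \<ge> 0 \<Longrightarrow> (\<Sum>j\<in>I - {i}. w i j t) \<le> K"
    and delay: "i \<in> I \<Longrightarrow> j \<in> I \<Longrightarrow> t \<ge> 0 \<Longrightarrow> 0 \<le> d i j t \<and> d i j t \<le> \<tau>"
begin

text \<open>By this symmetry only upper bounds have to be proved directly; lower bounds come from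
  the interpretations named \<open>neg\<close>.\<close>

lemma delayed_averaging_uminus: "delayed_averaging I w d \<tau> K (\<lambda>i t. - f i t)"
proof
  fix i assume i: "i \<in> I"
  show "continuous_on {-\<tau>..} (\<lambda>t. - f i t)" using cont[OF i] by (intro continuous_intros)
  show "locally_abs_continuous_on {0..} (\<lambda>t. - f i t)"
    using abs_cont[OF i] abs_continuous_on_diff_const[of _ _ "f i" 0]
    by (simp add: locally_abs_continuous_on_def)
  show "AE t in lebesgue. t > 0 \<longrightarrow> ((\<lambda>t. - f i t) has_real_derivative
      (\<Sum>j\<in>I - {i}. w i j t * (- f j (t - d i j t) - - f i t))) (at t)"
    using deriv[OF i]
  proof eventually_elim
    case (elim t)
    have "(\<Sum>j\<in>I - {i}. w i j t * (- f j (t - d i j t) - - f i t)) =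
        - (\<Sum>j\<in>I - {i}. w i j t * (f j (t - d i j t) - f i t))"
      by (subst sum_negf[symmetric]) (simp add: algebra_simps)
    then show ?case using elim DERIV_minus by auto
  qed
qed (use finite_I \<tau>_nonneg K_nonneg weight_nonneg weight_sum delay in auto)

text \<open>The derivative of the gap \<open>M - f i\<close> is the weighted sum of the delayed gaps
  of the others minus the total weight times the gap itself, and the latter term is at most
  \<open>K * (M - f i)\<close>. The bound \<open>M\<close> is assumed only strictly before
  \<open>b\<close>, so the estimate reaches up to the first time at which a bound could
  fail.\<close>

lemma gap_lower_bound:
  assumes i: "i \<in> I" and ab: "0 \<le> a" "a \<le> b"
    and M: "\<And>j t. j \<in> I \<Longrightarrow> a - \<tau> \<le> t \<Longrightarrow> t < b \<Longrightarrow> f j t \<le> M"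
    and h: "\<And>t. t \<in> {a..b} \<Longrightarrow> h t \<ge> 0" "(h has_integral H) {a..b}"
    and h_le: "\<And>t. a < t \<Longrightarrow> t < b \<Longrightarrow> h t \<le> (\<Sum>j\<in>I - {i}. w i j t * (M - f j (t - d i j t)))"
  shows "exp (- K * (b - a)) * (M - f i a + H) \<le> M - f i b"
proof (rule integrating_factor_lower_bound[OF ab(2) K_nonneg _ _ _ h])
  show "abs_continuous_on_interval a b (\<lambda>t. M - f i t)"
    using abs_cont[OF i] ab
    by (intro abs_continuous_on_diff_const) (auto simp: locally_abs_continuous_on_def)
  show "continuous_on {a..b} (\<lambda>t. M - f i t)"
    using \<tau>_nonneg ab by (intro continuous_intros continuous_on_subset[OF cont[OF i]]) auto
  show "AE t in lebesgue. a < t \<and> t < b \<longrightarrow>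
      ((\<lambda>t. M - f i t) has_real_derivative - (\<Sum>j\<in>I - {i}. w i j t * (f j (t - d i j t) - f i t))) (at t) \<and>
      h t \<le> - (\<Sum>j\<in>I - {i}. w i j t * (f j (t - d i j t) - f i t)) + K * (M - f i t)"
    using deriv[OF i]
  proof eventually_elim
    case (elim t)
    show ?case
    proof (intro impI conjI)
      assume t: "a < t \<and> t < b"
      then have D: "(f i has_real_derivative (\<Sum>j\<in>I - {i}. w i j t * (f j (t - d i j t) - f i t))) (at t)"
        using elim ab by auto
      show "((\<lambda>t. M - f i t) has_real_derivative
          - (\<Sum>j\<in>I - {i}. w i j t * (f j (t - d i j t) - f i t))) (at t)"
        using DERIV_diff[OF DERIV_const D, of M] by simp
      have "M - f i t \<ge> 0" using M[OF i, of t] t \<tau>_nonneg by auto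
      then have "(\<Sum>j\<in>I - {i}. w i j t) * (M - f i t) \<le> K * (M - f i t)"
        using weight_sum[OF i, of t] t ab by (intro mult_right_mono) auto
      moreover have "- (\<Sum>j\<in>I - {i}. w i j t * (f j (t - d i j t) - f i t)) =
          (\<Sum>j\<in>I - {i}. w i j t * (M - f j (t - d i j t))) - (\<Sum>j\<in>I - {i}. w i j t) * (M - f i t)"
        unfolding sum_distrib_right sum_subtractf[symmetric] sum_negf[symmetric]
        by (intro sum.cong) (auto simp: algebra_simps)
      ultimately show "h t \<le> - (\<Sum>j\<in>I - {i}. w i j t * (f j (t - d i j t) - f i t)) + K * (M - f i t)"
        using h_le[of t] t by linarith
    qed
  qed
qed

lemma gap_exp_lower_bound:
  assumes i: "i \<in> I" and ab: "0 \<le> a" "a \<le> b"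
    and M: "\<And>j t. j \<in> I \<Longrightarrow> a - \<tau> \<le> t \<Longrightarrow> t < b \<Longrightarrow> f j t \<le> M"
  shows "exp (- K * (b - a)) * (M - f i a) \<le> M - f i b"
proof -
  have "0 \<le> (\<Sum>j\<in>I - {i}. w i j t * (M - f j (t - d i j t)))" if t: "a < t" "t < b" for t
  proof (intro sum_nonneg mult_nonneg_nonneg)
    fix j assume j: "j \<in> I - {i}"
    show "0 \<le> w i j t" using weight_nonneg[of i j t] i j t ab by auto
    have "0 \<le> d i j t \<and> d i j t \<le> \<tau>" using delay[of i j t] i j t ab by auto
    then show "0 \<le> M - f j (t - d i j t)" using M[of j "t - d i j t"] j t by auto
  qed
  then show ?thesis
    using gap_lower_bound[OF i ab M, where h = "\<lambda>_. 0" and H = 0] by simp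
qed

text \<open>At the first time a level above \<open>M\<close> were reached, all delayed values
  would still lie below that level, and the gap to it can only decay exponentially.\<close>
lemma upper_bound_invariant:
  assumes "0 \<le> s" and M: "\<And>j t. j \<in> I \<Longrightarrow> s - \<tau> \<le> t \<Longrightarrow> t \<le> s \<Longrightarrow> f j t \<le> M"
    and i: "i \<in> I" and t: "s - \<tau> \<le> t"
  shows "f i t \<le> M"
proof (rule ccontr)
  assume "\<not> f i t \<le> M"
  then have "t > s" and gt: "f i t > M" using M[OF i, of t] t by force+
  define L where "L = f i t"
  define S where "S = (\<Union>j\<in>I. {r \<in> {s..t}. L \<le> f j r})"
  have "closed {r \<in> {s..t}. L \<le> f j r}" if "j \<in> I" for j
  proof -
    have "closed ({s..t} \<inter> f j -` {L..})"
      using \<open>0 \<le> s\<close> \<tau>_nonneg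
      by (intro continuous_closed_preimage continuous_on_subset[OF cont[OF that]]) auto
    then show ?thesis by (simp add: vimage_def Int_def)
  qed
  then have clS: "closed S" unfolding S_def using finite_I by (intro closed_UN) auto
  have "t \<in> S" using i \<open>t > s\<close> by (auto simp: S_def L_def)
  have bdd: "bdd_below S" by (auto simp: S_def bdd_below_def)
  define t1 where "t1 = Inf S"
  have "t1 \<in> S" unfolding t1_def using closed_contains_Inf[OF _ bdd clS] \<open>t \<in> S\<close> by auto
  then obtain j where j: "j \<in> I" "s \<le> t1" "t1 \<le> t" "L \<le> f j t1" by (auto simp: S_def)
  have below: "f k r \<le> L" if "k \<in> I" "s - \<tau> \<le> r" "r < t1" for k r
  proof (cases "r \<le> s")
    case True then show ?thesis using M[of k r] that gt by (auto simp: L_def)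
  next
    case False
    have "r \<notin> S" using cInf_lower[OF _ bdd, of r] that unfolding t1_def by auto
    then show ?thesis using that False j by (auto simp: S_def)
  qed
  have "exp (- K * (t1 - s)) * (L - f j s) \<le> L - f j t1"
    using below by (intro gap_exp_lower_bound[OF j(1) \<open>0 \<le> s\<close> j(2)]) auto
  moreover have "L - f j s > 0" using M[OF j(1), of s] gt \<tau>_nonneg by (simp add: L_def)
  then have "exp (- K * (t1 - s)) * (L - f j s) > 0" by simp
  ultimately show False using j(4) by linarith
qed

text \<open>The gap below \<open>M\<close> of agent \<open>l\<close> is passed on along each arc within time \<open>T + \<tau>\<close>: after a
  delay \<open>\<tau>\<close> the neighbour only sees values with the gap, and over a time \<open>T\<close> the excitation of the
  arc is at least \<open>\<alpha>0\<close>.\<close>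
lemma gap_spread:
  fixes R :: "('i \<times> 'i) set" and \<alpha> :: "'i \<Rightarrow> 'i \<Rightarrow> real \<Rightarrow> real"
  assumes "0 \<le> s" and M: "\<And>j t. j \<in> I \<Longrightarrow> s - \<tau> \<le> t \<Longrightarrow> t \<le> s \<Longrightarrow> f j t \<le> M"
    and R: "\<And>i j. (i, j) \<in> R \<Longrightarrow> i \<in> I \<and> j \<in> I \<and> i \<noteq> j"
    and w: "\<And>i j t. (i, j) \<in> R \<Longrightarrow> s \<le> t \<Longrightarrow> t \<le> s + h \<Longrightarrow> \<kappa> * \<alpha> i j t \<le> w i j t"
    and \<alpha>: "\<And>i j t. (i, j) \<in> R \<Longrightarrow> 0 \<le> t \<Longrightarrow> 0 \<le> \<alpha> i j t"
    and \<alpha>_int: "\<And>i j t. (i, j) \<in> R \<Longrightarrow> 0 \<le> t \<Longrightarrow>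
      \<alpha> i j integrable_on {t..t + T} \<and> \<alpha>0 \<le> integral {t..t + T} (\<alpha> i j)"
    and "0 \<le> \<kappa>" "0 \<le> T" "0 \<le> q" and q_le: "q \<le> exp (- K * T) * \<kappa> * \<alpha>0"
    and l: "l \<in> I" "f l s \<le> M - \<Delta>" and "0 \<le> \<Delta>"
    and path: "(i, l) \<in> R ^^ k"
    and i: "i \<in> I"
    and t: "s + real k * (T + \<tau>) \<le> t" "t \<le> s + h"
  shows "q ^ k * (exp (- K * h) * \<Delta>) \<le> M - f i t"
  using path i t
proof (induction k arbitrary: i t)
  case 0
  then have [simp]: "i = l" by simp
  have t: "s \<le> t" "t \<le> s + h" using 0 by auto
  \<comment> \<open>The decay of the gap of \<open>l\<close> itself over the whole period is paid
    once, here; the decay over each later interval of length \<open>T\<close> is contained in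
    \<open>q\<close>.\<close>
  have "exp (- K * h) * \<Delta> \<le> exp (- K * (t - s)) * \<Delta>"
    using t K_nonneg \<open>0 \<le> \<Delta>\<close> by (intro mult_right_mono) (auto intro!: mult_left_mono)
  also have "\<dots> \<le> exp (- K * (t - s)) * (M - f l s)"
    using l(2) by (intro mult_left_mono) auto
  also have "\<dots> \<le> M - f l t"
    using upper_bound_invariant[OF \<open>0 \<le> s\<close> M] by (intro gap_exp_lower_bound[OF l(1) \<open>0 \<le> s\<close> t(1)]) auto
  finally show ?case by simp
next
  case (Suc k)
  obtain j where j: "(i, j) \<in> R" "(j, l) \<in> R ^^ k" using Suc.prems(1) by (metis relpow_Suc_D2)
  have ij: "i \<in> I" "j \<in> I" "i \<noteq> j" using R j by auto
  define \<delta> where "\<delta> = q ^ k * (exp (- K * h) * \<Delta>)"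
  have "\<delta> \<ge> 0" unfolding \<delta>_def using \<open>0 \<le> q\<close> \<open>0 \<le> \<Delta>\<close> by simp
  \<comment> \<open>The arc \<open>(i, j)\<close> acts on \<open>[t - T, t]\<close>: there every
    delayed time is at least \<open>a - \<tau>\<close>, hence at least
    \<open>s + real k * (T + \<tau>)\<close>, where the induction hypothesis covers
    \<open>j\<close>. The gap of \<open>i\<close> at time \<open>a\<close> contributes only its
    nonnegativity.\<close>
  define a where "a = t - T"
  have a_ge: "a \<ge> s + real k * (T + \<tau>) + \<tau>" using Suc.prems(3) by (simp add: a_def algebra_simps)
  moreover have "0 \<le> real k * (T + \<tau>)" using \<open>0 \<le> T\<close> \<tau>_nonneg by simp
  ultimately have a: "a \<ge> s + \<tau>" "a \<le> t" "t = a + T" using \<open>0 \<le> T\<close> by (auto simp: a_def)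
  have "a \<ge> 0" using a(1) \<open>0 \<le> s\<close> \<tau>_nonneg by linarith
  have below: "f j r \<le> M" if "j \<in> I" "s - \<tau> \<le> r" for j r
    using upper_bound_invariant[OF \<open>0 \<le> s\<close> M that] .
  have "exp (- K * (t - a)) * (M - f i a + \<kappa> * \<delta> * integral {a..t} (\<alpha> i j)) \<le> M - f i t"
  proof (rule gap_lower_bound[OF ij(1) \<open>a \<ge> 0\<close> a(2), where h = "\<lambda>r. \<kappa> * \<delta> * \<alpha> i j r"])
    show "f j r \<le> M" if "j \<in> I" "a - \<tau> \<le> r" for j r using below[OF that(1)] that a(1) \<tau>_nonneg by auto
    show "0 \<le> \<kappa> * \<delta> * \<alpha> i j r" if "r \<in> {a..t}" for r
      using \<alpha>[OF j(1), of r] that \<open>a \<ge> 0\<close> \<open>\<delta> \<ge> 0\<close> \<open>0 \<le> \<kappa>\<close> by simp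
    show "((\<lambda>r. \<kappa> * \<delta> * \<alpha> i j r) has_integral \<kappa> * \<delta> * integral {a..t} (\<alpha> i j)) {a..t}"
      using \<alpha>_int[OF j(1) \<open>a \<ge> 0\<close>] unfolding a(3)
      by (intro has_integral_mult_right) (auto intro: integrable_integral)
    fix r assume r: "a < r" "r < t"
    have r0: "r \<ge> 0" "s \<le> r" "r \<le> s + h" using r a \<open>a \<ge> 0\<close> Suc.prems(4) \<tau>_nonneg by auto
    have nonneg: "0 \<le> w i k r * (M - f k (r - d i k r))" if "k \<in> I" for k
      using weight_nonneg[OF ij(1) that r0(1)] delay[OF ij(1) that r0(1)] r a(1)
      by (intro mult_nonneg_nonneg) (auto intro!: below[OF that])
    have dl: "0 \<le> d i j r \<and> d i j r \<le> \<tau>" using delay[OF ij(1,2) r0(1)] .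
    have "\<delta> \<le> M - f j (r - d i j r)" unfolding \<delta>_def
      using dl r a_ge r0 by (intro Suc.IH[OF j(2) ij(2)]) auto
    then have "\<kappa> * \<alpha> i j r * \<delta> \<le> w i j r * (M - f j (r - d i j r))"
      using w[OF j(1) r0(2,3)] \<open>\<delta> \<ge> 0\<close> weight_nonneg[OF ij(1,2) r0(1)] by (intro mult_mono) auto
    also have "\<dots> \<le> (\<Sum>j\<in>I - {i}. w i j r * (M - f j (r - d i j r)))"
      using nonneg ij finite_I by (intro member_le_sum) auto
    finally show "\<kappa> * \<delta> * \<alpha> i j r \<le> (\<Sum>j\<in>I - {i}. w i j r * (M - f j (r - d i j r)))"
      by (simp add: algebra_simps)
  qed
  moreover have "exp (- K * T) * (\<kappa> * \<delta> * \<alpha>0) \<le> exp (- K * (t - a)) * (M - f i a + \<kappa> * \<delta> * integral {a..t} (\<alpha> i j))"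
  proof -
    have "\<kappa> * \<delta> * \<alpha>0 \<le> \<kappa> * \<delta> * integral {a..t} (\<alpha> i j)"
      using \<alpha>_int[OF j(1) \<open>a \<ge> 0\<close>] \<open>0 \<le> \<kappa>\<close> \<open>\<delta> \<ge> 0\<close> unfolding a(3) by (intro mult_left_mono) auto
    moreover have "f i a \<le> M" using below[OF ij(1), of a] a \<tau>_nonneg by auto
    ultimately show ?thesis using a(3) by simp
  qed
  moreover have "q * \<delta> \<le> exp (- K * T) * \<kappa> * \<alpha>0 * \<delta>"
    using q_le \<open>\<delta> \<ge> 0\<close> by (rule mult_right_mono)
  ultimately show ?case unfolding \<delta>_def by (simp add: algebra_simps)
qed

text \<open>Taking \<open>M\<close> as the supremum of all values in the window puts every value
  into \<open>[M - D, M]\<close>. The lower bound is phrased for \<open>- f\<close>, ready for the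
  sign-reversed system.\<close>

lemma window_bounds:
  assumes diam: "\<And>i j r t. i \<in> I \<Longrightarrow> j \<in> I \<Longrightarrow> r \<in> {s - \<tau>..s} \<Longrightarrow> t \<in> {s - \<tau>..s} \<Longrightarrow> f i r - f j t \<le> D"
  obtains M where "\<And>i r. i \<in> I \<Longrightarrow> s - \<tau> \<le> r \<Longrightarrow> r \<le> s \<Longrightarrow> f i r \<le> M"
    and "\<And>i r. i \<in> I \<Longrightarrow> s - \<tau> \<le> r \<Longrightarrow> r \<le> s \<Longrightarrow> - f i r \<le> - (M - D)"
proof (cases "I = {}")
  case False
  then obtain l where l: "l \<in> I" by blast
  define W where "W = (\<Union>i\<in>I. f i ` {s - \<tau>..s})"
  have "f l s \<in> W" unfolding W_def using l \<tau>_nonneg by (intro UN_I[of l] imageI) auto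
  have bdd: "bdd_above W"
    unfolding bdd_above_def using diam[OF _ l, of _ _ s] \<tau>_nonneg
    by (intro exI[of _ "D + f l s"]) (force simp: W_def algebra_simps)
  show ?thesis
  proof (rule that)
    show "f i r \<le> Sup W" if "i \<in> I" "s - \<tau> \<le> r" "r \<le> s" for i r
      using that by (intro cSup_upper[OF _ bdd]) (auto simp: W_def intro!: bexI[of _ i])
    show "- f i r \<le> - (Sup W - D)" if "i \<in> I" "s - \<tau> \<le> r" "r \<le> s" for i r
    proof -
      have "Sup W \<le> f i r + D"
        using diam[OF _ that(1), of _ _ r] that \<open>f l s \<in> W\<close>
        by (intro cSup_least) (force simp: W_def algebra_simps)+
      then show ?thesis by simp
    qed
  qed
qed auto

lemma diameter_invariant:
  assumes "0 \<le> s"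
    and diam: "\<And>i j r t. i \<in> I \<Longrightarrow> j \<in> I \<Longrightarrow> r \<in> {s - \<tau>..s} \<Longrightarrow> t \<in> {s - \<tau>..s} \<Longrightarrow> f i r - f j t \<le> D"
    and "i \<in> I" "j \<in> I" "s - \<tau> \<le> r" "s - \<tau> \<le> t"
  shows "f i r - f j t \<le> D"
proof -
  interpret neg: delayed_averaging I w d \<tau> K "\<lambda>i t. - f i t" by (rule delayed_averaging_uminus)
  obtain M where up: "\<And>i r. i \<in> I \<Longrightarrow> s - \<tau> \<le> r \<Longrightarrow> r \<le> s \<Longrightarrow> f i r \<le> M"
    and low: "\<And>i r. i \<in> I \<Longrightarrow> s - \<tau> \<le> r \<Longrightarrow> r \<le> s \<Longrightarrow> - f i r \<le> - (M - D)"
    using window_bounds[OF diam] by blast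
  show ?thesis
    using upper_bound_invariant[OF \<open>0 \<le> s\<close> up \<open>i \<in> I\<close> \<open>s - \<tau> \<le> r\<close>]
      neg.upper_bound_invariant[OF \<open>0 \<le> s\<close> low \<open>j \<in> I\<close> \<open>s - \<tau> \<le> t\<close>] by simp
qed

text \<open>Only one end of \<open>[M - D, M]\<close> moves inwards; the other merely persists. A
  starting gap \<open>D / 2\<close> loses the factor \<open>exp (- K * h)\<close> and at most
  \<open>\<gamma>\<close> factors \<open>q\<close>; since \<open>q \<le> 1\<close>, the power with
  exponent \<open>\<gamma>\<close> serves all agents, whatever the length of their path to
  \<open>l\<close>. From \<open>s + real \<gamma> * (T + \<tau>)\<close> on, all paths have had time
  to act.\<close>

lemma diameter_contraction:
  fixes R :: "('i \<times> 'i) set" and \<alpha> :: "'i \<Rightarrow> 'i \<Rightarrow> real \<Rightarrow> real"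
  assumes "0 \<le> s"
    and diam: "\<And>i j r t. i \<in> I \<Longrightarrow> j \<in> I \<Longrightarrow> r \<in> {s - \<tau>..s} \<Longrightarrow> t \<in> {s - \<tau>..s} \<Longrightarrow> f i r - f j t \<le> D"
    and R: "\<And>i j. (i, j) \<in> R \<Longrightarrow> i \<in> I \<and> j \<in> I \<and> i \<noteq> j"
    and w: "\<And>i j t. (i, j) \<in> R \<Longrightarrow> s \<le> t \<Longrightarrow> t \<le> s + h \<Longrightarrow> \<kappa> * \<alpha> i j t \<le> w i j t"
    and \<alpha>: "\<And>i j t. (i, j) \<in> R \<Longrightarrow> 0 \<le> t \<Longrightarrow> 0 \<le> \<alpha> i j t"
    and \<alpha>_int: "\<And>i j t. (i, j) \<in> R \<Longrightarrow> 0 \<le> t \<Longrightarrow>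
      \<alpha> i j integrable_on {t..t + T} \<and> \<alpha>0 \<le> integral {t..t + T} (\<alpha> i j)"
    and \<kappa>: "0 \<le> \<kappa>" and T: "0 \<le> T" and q: "0 \<le> q" "q \<le> exp (- K * T) * \<kappa> * \<alpha>0" "q \<le> 1"
    and l: "l \<in> I" and paths: "\<And>i. i \<in> I \<Longrightarrow> \<exists>k\<le>\<gamma>. (i, l) \<in> R ^^ k"
    and ij: "i \<in> I" "j \<in> I"
    and r: "s + real \<gamma> * (T + \<tau>) \<le> r" "r \<le> s + h"
    and t: "s + real \<gamma> * (T + \<tau>) \<le> t" "t \<le> s + h"
  shows "f i r - f j t \<le> (1 - exp (- K * h) / 2 * q ^ \<gamma>) * D"
proof -
  obtain M where up: "\<And>i r. i \<in> I \<Longrightarrow> s - \<tau> \<le> r \<Longrightarrow> r \<le> s \<Longrightarrow> f i r \<le> M"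
    and low: "\<And>i r. i \<in> I \<Longrightarrow> s - \<tau> \<le> r \<Longrightarrow> r \<le> s \<Longrightarrow> - f i r \<le> - (M - D)"
    using window_bounds[OF diam] by blast
  have "D \<ge> 0" using diam[OF l l, of s s] \<tau>_nonneg by simp
  interpret neg: delayed_averaging I w d \<tau> K "\<lambda>i t. - f i t" by (rule delayed_averaging_uminus)
  define C where "C = exp (- K * h) / 2 * q ^ \<gamma>"
  have start: "s \<le> r'" "s - \<tau> \<le> r'" if "s + real \<gamma> * (T + \<tau>) \<le> r'" for r'
  proof -
    have "0 \<le> real \<gamma> * (T + \<tau>)" using T \<tau>_nonneg by simp
    then show "s \<le> r'" "s - \<tau> \<le> r'" using that \<tau>_nonneg by linarith+
  qed
  have shift: "s + real k * (T + \<tau>) \<le> r'" if "s + real \<gamma> * (T + \<tau>) \<le> r'" "k \<le> \<gamma>" for k r'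
    using that T \<tau>_nonneg mult_right_mono[of "real k" "real \<gamma>" "T + \<tau>"] by linarith
  have C_le: "C * D \<le> q ^ k * (exp (- K * h) * (D / 2))" if "k \<le> \<gamma>" for k
  proof -
    have "q ^ \<gamma> * (exp (- K * h) * (D / 2)) \<le> q ^ k * (exp (- K * h) * (D / 2))"
      using power_decreasing[OF that q(1,3)] \<open>D \<ge> 0\<close> by (intro mult_right_mono) auto
    then show ?thesis by (simp add: C_def algebra_simps)
  qed
  \<comment> \<open>At time \<open>s\<close> agent \<open>l\<close> is at distance at least \<open>D / 2\<close> from one end of \<open>[M - D, M]\<close>.\<close>
  have "f i r - f j t \<le> D - C * D"
  proof (cases "f l s \<le> M - D / 2")
    case True
    obtain k where k: "k \<le> \<gamma>" "(i, l) \<in> R ^^ k" using paths[OF ij(1)] by blast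
    have "q ^ k * (exp (- K * h) * (D / 2)) \<le> M - f i r"
      using gap_spread[OF \<open>0 \<le> s\<close> up R w \<alpha> \<alpha>_int \<kappa> T q(1,2) l True _ k(2) ij(1) shift[OF r(1) k(1)] r(2)]
        \<open>D \<ge> 0\<close> by simp
    moreover have "- f j t \<le> - (M - D)"
      by (rule neg.upper_bound_invariant[OF \<open>0 \<le> s\<close> low ij(2) start(2)[OF t(1)]])
    ultimately show ?thesis using C_le[OF k(1)] by linarith
  next
    case False
    then have False': "- f l s \<le> - (M - D) - D / 2" by (simp add: field_simps)
    obtain k where k: "k \<le> \<gamma>" "(j, l) \<in> R ^^ k" using paths[OF ij(2)] by blast
    have "q ^ k * (exp (- K * h) * (D / 2)) \<le> - (M - D) - - f j t"
      using neg.gap_spread[OF \<open>0 \<le> s\<close> low R w \<alpha> \<alpha>_int \<kappa> T q(1,2) l False' _ k(2) ij(2) shift[OF t(1) k(1)] t(2)]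
        \<open>D \<ge> 0\<close> by simp
    moreover have "f i r \<le> M"
      by (rule upper_bound_invariant[OF \<open>0 \<le> s\<close> up ij(1) start(2)[OF r(1)]])
    ultimately show ?thesis using C_le[OF k(1)] by linarith
  qed
  then show ?thesis by (simp add: C_def algebra_simps)
qed

end

subsection \<open>Boundedness from a divergent integral\<close>

text \<open>If \<open>y\<close> were unbounded, the intervals between consecutive terms would cover
  everything beyond \<open>y 0\<close>, and monotonicity bounds \<open>\<phi>\<close> on each by its
  value at the left end. The integral would then be at most \<open>\<phi> 0 * y 0 + B\<close>, which
  is finite.\<close>

lemma bounded_if_weighted_increments_summable:
  fixes \<phi> :: "real \<Rightarrow> real" and y :: "nat \<Rightarrow> real"
  assumes anti: "\<And>s t. 0 \<le> s \<Longrightarrow> s \<le> t \<Longrightarrow> \<phi> t \<le> \<phi> s" and nonneg: "\<And>t. 0 \<le> t \<Longrightarrow> 0 \<le> \<phi> t"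
    and y: "incseq y" "0 \<le> y 0"
    and sum_le: "\<And>n. (\<Sum>k<n. \<phi> (y k) * (y (Suc k) - y k)) \<le> B"
    and div: "(\<integral>\<^sup>+t\<in>{0..}. ennreal (\<phi> t) \<partial>lebesgue) = \<infinity>"
  shows "\<exists>Y. \<forall>n. y n \<le> Y"
proof (rule ccontr)
  assume "\<not> ?thesis"
  then have unbdd: "\<exists>n. t < y n" for t by (meson not_le)
  have y_nonneg: "0 \<le> y k" for k using y incseqD[of y 0 k] by simp
  \<comment> \<open>Adjacent closed intervals share endpoints; counting these twice is harmless
    because only an upper bound for \<open>\<phi>\<close> is needed.\<close>
  let ?g = "\<lambda>t. ennreal (\<phi> 0) * indicator {0..y 0} t +
    (\<Sum>k. ennreal (\<phi> (y k)) * indicator {y k..y (Suc k)} t)"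
  have "ennreal (\<phi> t) * indicator {0..} t \<le> ?g t" for t
  proof (cases "0 \<le> t")
    case t: True
    define n where "n = (LEAST n. t < y n)"
    have n: "t < y n" unfolding n_def using unbdd by (rule LeastI_ex)
    show ?thesis
    proof (cases n)
      case 0
      then have "ennreal (\<phi> t) \<le> ennreal (\<phi> 0) * indicator {0..y 0} t"
        using n t anti[of 0 t] by (simp add: ennreal_leI)
      then show ?thesis using t by (simp add: add_increasing2)
    next
      case (Suc k)
      then have k: "y k \<le> t" using not_less_Least[of k "\<lambda>n. t < y n"] by (simp add: n_def)
      have "ennreal (\<phi> t) \<le> ennreal (\<phi> (y k)) * indicator {y k..y (Suc k)} t"
        using n k Suc anti[of "y k" t] y_nonneg by (simp add: ennreal_leI)
      also have "\<dots> = (\<Sum>k\<in>{k}. ennreal (\<phi> (y k)) * indicator {y k..y (Suc k)} t)" 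
        by (simp only: sum.insert finite.emptyI empty_iff not_False_eq_True sum.empty add_0_right)
      also have "\<dots> \<le> (\<Sum>k. ennreal (\<phi> (y k)) * indicator {y k..y (Suc k)} t)"
        by (intro sum_le_suminf) auto
      finally show ?thesis using t by (simp add: add_increasing)
    qed
  qed simp
  then have "(\<integral>\<^sup>+t\<in>{0..}. ennreal (\<phi> t) \<partial>lebesgue) \<le> (\<integral>\<^sup>+t. ?g t \<partial>lebesgue)"
    by (intro nn_integral_mono) simp
  also have "\<dots> = ennreal (\<phi> 0) * ennreal (y 0) + (\<Sum>k. ennreal (\<phi> (y k)) * ennreal (y (Suc k) - y k))"
  proof -
    have [measurable]: "{a..b} \<in> sets lebesgue" for a b :: real by simp
    have "(\<integral>\<^sup>+t. ?g t \<partial>lebesgue) = (\<integral>\<^sup>+t. ennreal (\<phi> 0) * indicator {0..y 0} t \<partial>lebesgue) +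
        (\<integral>\<^sup>+t. (\<Sum>k. ennreal (\<phi> (y k)) * indicator {y k..y (Suc k)} t) \<partial>lebesgue)"
      by (rule nn_integral_add) measurable
    also have "(\<integral>\<^sup>+t. (\<Sum>k. ennreal (\<phi> (y k)) * indicator {y k..y (Suc k)} t) \<partial>lebesgue) =
        (\<Sum>k. \<integral>\<^sup>+t. ennreal (\<phi> (y k)) * indicator {y k..y (Suc k)} t \<partial>lebesgue)"
      by (rule nn_integral_suminf) measurable
    finally show ?thesis
      using y incseq_SucD[OF y(1)] by (simp add: nn_integral_cmult_indicator)
  qed
  also have "(\<Sum>k. ennreal (\<phi> (y k)) * ennreal (y (Suc k) - y k)) \<le> ennreal B"
  proof (rule suminf_le_const)
    fix n
    have "(\<Sum>k<n. ennreal (\<phi> (y k)) * ennreal (y (Suc k) - y k)) =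
        ennreal (\<Sum>k<n. \<phi> (y k) * (y (Suc k) - y k))"
      using nonneg[OF y_nonneg] incseq_SucD[OF y(1)]
      by (subst sum_ennreal[symmetric]) (auto simp: ennreal_mult)
    also have "\<dots> \<le> ennreal B" using sum_le by (rule ennreal_leI)
    finally show "(\<Sum>k<n. ennreal (\<phi> (y k)) * ennreal (y (Suc k) - y k)) \<le> ennreal B" .
  qed simp
  finally have "(\<infinity>::ennreal) \<le> ennreal (\<phi> 0) * ennreal (y 0) + ennreal B"
    using div by (simp add: add_left_mono)
  then show False
    using ennreal_mult_less_top by (metis ennreal_add_eq_top ennreal_neq_top ennreal_mult_eq_top_iff infinity_ennreal_def top.extremum_unique)
qed

text \<open>\<open>\<phi> (y (n + 1))\<close> is the largest value of \<open>\<phi>\<close> on the \<^emph>\<open>next\<close> interval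
  \<open>[y (n + 1), y (n + 2)]\<close>, whose length is \<open>h * D (n + 1) \<le> h * D n\<close>. Upper Riemann sums of
  \<open>\<phi>\<close> along \<open>y\<close> are therefore dominated by the telescoping sum of the decrements of \<open>D\<close>.\<close>
lemma bootstrap_decay:
  fixes \<phi> :: "real \<Rightarrow> real" and y D :: "nat \<Rightarrow> real"
  assumes anti: "\<And>s t. 0 \<le> s \<Longrightarrow> s \<le> t \<Longrightarrow> \<phi> t \<le> \<phi> s" and pos: "\<And>t. 0 \<le> t \<Longrightarrow> 0 < \<phi> t"
    and small: "\<And>t. 0 \<le> t \<Longrightarrow> c * \<phi> t \<le> 1 / 2"
    and "0 < h" "0 < c" "0 \<le> y 0" "0 \<le> D 0"
    and y_Suc: "\<And>n. y (Suc n) = y n + h * D n"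
    and D_Suc: "\<And>n. D (Suc n) = (1 - c * \<phi> (y (Suc n))) * D n"
    and div: "(\<integral>\<^sup>+t\<in>{0..}. ennreal (\<phi> t) \<partial>lebesgue) = \<infinity>"
  shows "\<exists>Y. \<forall>n. y n \<le> Y" and "\<exists>\<mu>>0. \<forall>n. D n \<le> D 0 * exp (- \<mu> * (real n * h))"
proof -
  have nonneg: "0 \<le> y n \<and> 0 \<le> D n" for n
  proof (induction n)
    case (Suc n)
    then have "0 \<le> y (Suc n)" using \<open>0 < h\<close> by (simp add: y_Suc)
    moreover from small[OF this] Suc have "0 \<le> D (Suc n)" by (simp add: D_Suc)
    ultimately show ?case by simp
  qed (use \<open>0 \<le> y 0\<close> \<open>0 \<le> D 0\<close> in simp)
  have y_le: "y n \<le> y (Suc n)" for n using nonneg[of n] \<open>0 < h\<close> by (simp add: y_Suc)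
  have "(\<Sum>k<n. \<phi> (y (Suc k)) * (y (Suc (Suc k)) - y (Suc k))) \<le> h / c * D 0" for n
  proof -
    have "\<phi> (y (Suc k)) * (y (Suc (Suc k)) - y (Suc k)) \<le> h / c * (D k - D (Suc k))" for k
    proof -
      have \<phi>: "0 < \<phi> (y (Suc k))" using pos nonneg by blast
      have "D (Suc k) \<le> D k"
        using \<phi> nonneg[of k] \<open>0 < c\<close> by (simp add: D_Suc mult_left_le_one_le algebra_simps)
      then have "\<phi> (y (Suc k)) * (h * D (Suc k)) \<le> \<phi> (y (Suc k)) * (h * D k)"
        using \<phi> \<open>0 < h\<close> by simp
      then show ?thesis using \<open>0 < c\<close> by (simp add: y_Suc[of "Suc k"] D_Suc[of k] field_simps)
    qed
    then have "(\<Sum>k<n. \<phi> (y (Suc k)) * (y (Suc (Suc k)) - y (Suc k))) \<le> (\<Sum>k<n. h / c * (D k - D (Suc k)))"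
      by (rule sum_mono)
    also have "\<dots> = h / c * (D 0 - D n)"
      unfolding sum_distrib_left[symmetric] sum_lessThan_telescope' ..
    also have "\<dots> \<le> h / c * D 0" using nonneg[of n] \<open>0 < h\<close> \<open>0 < c\<close> by (intro mult_left_mono) auto
    finally show ?thesis .
  qed
  then have "\<exists>Y. \<forall>n. y (Suc n) \<le> Y"
    using anti pos y_le nonneg div
    by (intro bounded_if_weighted_increments_summable[of \<phi> "\<lambda>n. y (Suc n)"])
       (auto simp: incseq_Suc_iff less_imp_le)
  then obtain Y where Y: "y (Suc n) \<le> Y" for n by blast
  have Y': "y n \<le> Y" for n using Y[of n] y_le[of n] by simp
  then show "\<exists>Y. \<forall>n. y n \<le> Y" by blast
  have "0 \<le> Y" using Y'[of 0] \<open>0 \<le> y 0\<close> by simp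
  \<comment> \<open>\<open>\<mu> * h = c * \<phi> Y\<close> is the contraction at the distance bound
    \<open>Y\<close>. By monotonicity every period contracts at least as much, and
    \<open>1 - z \<le> exp (- z)\<close> turns the product of factors into an exponential.\<close>
  define \<mu> where "\<mu> = c * \<phi> Y / h"
  have "\<mu> > 0" using pos[OF \<open>0 \<le> Y\<close>] \<open>0 < c\<close> \<open>0 < h\<close> by (simp add: \<mu>_def)
  moreover have "D n \<le> D 0 * exp (- \<mu> * (real n * h))" for n
  proof (induction n)
    case (Suc n)
    have "1 - c * \<phi> (y (Suc n)) \<le> 1 - \<mu> * h"
      using anti[of "y (Suc n)" Y] Y[of n] nonneg \<open>0 < h\<close> \<open>0 < c\<close> by (simp add: \<mu>_def)
    also have "\<dots> \<le> exp (- \<mu> * h)" using exp_ge_add_one_self[of "- \<mu> * h"] by simp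
    finally have "D (Suc n) \<le> exp (- \<mu> * h) * (D 0 * exp (- \<mu> * (real n * h)))"
      unfolding D_Suc using Suc nonneg[of n] by (intro mult_mono) auto
    then show ?case by (simp add: algebra_simps flip: exp_add)
  qed simp
  ultimately show "\<exists>\<mu>>0. \<forall>n. D n \<le> D 0 * exp (- \<mu> * (real n * h))" by blast
qed

subsection \<open>Walks\<close>

lemma vwalk_imp_relpow:
  assumes "vwalk p (with_proj G)"
  shows "(hd p, last p) \<in> parcs G ^^ vwalk_length p"
  using assms
proof (induction p rule: vwalk_arcs.induct)
  case (3 x y xs)
  then have "(x, y) \<in> parcs G" "vwalk (y # xs) (with_proj G)"
    by (auto simp: vwalk_def arcs_ends_def arc_to_ends_def)
  then have "(y, last (y # xs)) \<in> parcs G ^^ vwalk_length (y # xs)" using 3 by simp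
  with \<open>(x, y) \<in> parcs G\<close> have "(x, last (y # xs)) \<in> parcs G ^^ Suc (vwalk_length (y # xs))"
    by (rule relpow_Suc_I2)
  then show ?case by simp
qed (auto simp: vwalk_def)

text \<open>Strong connectivity makes \<open>path_lengths G i j\<close> nonempty, so the infimum is
  attained by an actual path and is not the default value 0. The path then yields a power of the arc
  relation, the form in which the gap estimate consumes it.\<close>

lemma relpow_le_graph_depth:
  assumes "pair_digraph G" "strongly_connected (with_proj G)" "i \<in> pverts G" "j \<in> pverts G"
  shows "\<exists>k\<le>graph_depth G. (i, j) \<in> parcs G ^^ k"
proof -
  interpret pair_digraph G by fact
  have "i \<rightarrow>\<^sup>*\<^bsub>with_proj G\<^esub> j" using assms by auto
  then obtain p where "vpath p (with_proj G)" "hd p = i" "last p = j"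
    unfolding reachable_vwalk_conv using vwalk_imp_ex_vpath by metis
  then have "path_lengths G i j \<noteq> {}" unfolding path_lengths_def by blast
  then have "graph_dist G i j \<in> path_lengths G i j"
    unfolding graph_dist_def by (rule Inf_nat_def1)
  then have "(i, j) \<in> parcs G ^^ graph_dist G i j"
    unfolding path_lengths_def using vwalk_imp_relpow by (auto simp: vpath_def simp del: vwalk_length_simp)
  moreover have "graph_dist G i j \<le> graph_depth G"
    unfolding graph_depth_def using assms(3,4) finite_verts by (intro Max_ge) force+
  ultimately show ?thesis by blast
qed

subsection \<open>Vector-valued averaging and the flocking system\<close>

text \<open>Testing against the normalised vector \<open>sgn z\<close> recovers the norm. This is
  what makes scalar estimates, uniform in the direction, sufficient for the vector-valued
  system.\<close>

lemma norm_le_if_inner_le: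
  fixes z :: "'a::euclidean_space"
  assumes "\<And>u. norm u = 1 \<Longrightarrow> z \<bullet> u \<le> c"
  shows "norm z \<le> c"
proof (cases "z = 0")
  case True
  \<comment> \<open>For \<open>z = 0\<close> some unit vector is still needed to obtain
    \<open>0 \<le> c\<close>; a basis vector supplies it.\<close>
  then show ?thesis using assms[of "SOME i. i \<in> Basis"] SOME_Basis by auto
next
  case False
  then have "z \<bullet> sgn z = norm z"
    by (simp add: sgn_div_norm dot_square_norm power2_eq_square)
  then show ?thesis using assms[of "sgn z"] False by (simp add: norm_sgn)
qed

lemma inner_le_norm_unit:
  fixes z u :: "'a::real_inner"
  assumes "norm z \<le> c" "norm u = 1"
  shows "z \<bullet> u \<le> c"
  using norm_cauchy_schwarz[of z u] assms by simp


section \<open>Transfer of the scalar estimates to norms\<close>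

context
  fixes I :: "'i set" and w d :: "'i \<Rightarrow> 'i \<Rightarrow> real \<Rightarrow> real" and \<tau> K :: real
    and v :: "'i \<Rightarrow> real \<Rightarrow> 'a::euclidean_space"
  assumes proj: "\<And>u. delayed_averaging I w d \<tau> K (\<lambda>i t. v i t \<bullet> u)"
begin

lemma norm_bound_invariant:
  assumes "\<And>j t. j \<in> I \<Longrightarrow> - \<tau> \<le> t \<Longrightarrow> t \<le> 0 \<Longrightarrow> norm (v j t) \<le> V"
    and "i \<in> I" "- \<tau> \<le> t"
  shows "norm (v i t) \<le> V"
proof (rule norm_le_if_inner_le)
  fix u :: 'a assume u: "norm u = 1"
  show "v i t \<bullet> u \<le> V"
  proof (rule delayed_averaging.upper_bound_invariant[OF proj, of 0])
    show "v j r \<bullet> u \<le> V" if "j \<in> I" "0 - \<tau> \<le> r" "r \<le> 0" for j r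
      using inner_le_norm_unit[OF assms(1) u] that by simp
  qed (use assms in auto)
qed

lemma norm_diameter_invariant:
  assumes "0 \<le> s"
    and diam: "\<And>i j r t. i \<in> I \<Longrightarrow> j \<in> I \<Longrightarrow> r \<in> {s - \<tau>..s} \<Longrightarrow> t \<in> {s - \<tau>..s} \<Longrightarrow> norm (v i r - v j t) \<le> D"
    and "i \<in> I" "j \<in> I" "s - \<tau> \<le> r" "s - \<tau> \<le> t"
  shows "norm (v i r - v j t) \<le> D"
proof (rule norm_le_if_inner_le)
  fix u :: 'a assume u: "norm u = 1"
  have "v i r \<bullet> u - v j t \<bullet> u \<le> D"
  proof (rule delayed_averaging.diameter_invariant[OF proj \<open>0 \<le> s\<close> _ assms(3-)])
    show "v i r \<bullet> u - v j t \<bullet> u \<le> D"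
      if "i \<in> I" "j \<in> I" "r \<in> {s - \<tau>..s}" "t \<in> {s - \<tau>..s}" for i j r t
      using inner_le_norm_unit[OF diam[OF that] u] by (simp add: inner_diff_left)
  qed
  then show "(v i r - v j t) \<bullet> u \<le> D" by (simp add: inner_diff_left)
qed

text \<open>Which end of the range is far from agent \<open>l\<close> may change with the direction,
  but the root \<open>l\<close> and the factor do not, so one factor serves all unit
  vectors.\<close>

lemma norm_diameter_contraction:
  fixes R :: "('i \<times> 'i) set" and \<alpha> :: "'i \<Rightarrow> 'i \<Rightarrow> real \<Rightarrow> real"
  assumes "0 \<le> s"
    and diam: "\<And>i j r t. i \<in> I \<Longrightarrow> j \<in> I \<Longrightarrow> r \<in> {s - \<tau>..s} \<Longrightarrow> t \<in> {s - \<tau>..s} \<Longrightarrow> norm (v i r - v j t) \<le> D"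
    and R: "\<And>i j. (i, j) \<in> R \<Longrightarrow> i \<in> I \<and> j \<in> I \<and> i \<noteq> j"
    and w: "\<And>i j t. (i, j) \<in> R \<Longrightarrow> s \<le> t \<Longrightarrow> t \<le> s + h \<Longrightarrow> \<kappa> * \<alpha> i j t \<le> w i j t"
    and \<alpha>: "\<And>i j t. (i, j) \<in> R \<Longrightarrow> 0 \<le> t \<Longrightarrow> 0 \<le> \<alpha> i j t"
    and \<alpha>_int: "\<And>i j t. (i, j) \<in> R \<Longrightarrow> 0 \<le> t \<Longrightarrow>
      \<alpha> i j integrable_on {t..t + T} \<and> \<alpha>0 \<le> integral {t..t + T} (\<alpha> i j)"
    and \<kappa>: "0 \<le> \<kappa>" and T: "0 \<le> T" and q: "0 \<le> q" "q \<le> exp (- K * T) * \<kappa> * \<alpha>0" "q \<le> 1"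
    and l: "l \<in> I" and paths: "\<And>i. i \<in> I \<Longrightarrow> \<exists>k\<le>\<gamma>. (i, l) \<in> R ^^ k"
    and ij: "i \<in> I" "j \<in> I"
    and r: "s + real \<gamma> * (T + \<tau>) \<le> r" "r \<le> s + h"
    and t: "s + real \<gamma> * (T + \<tau>) \<le> t" "t \<le> s + h"
  shows "norm (v i r - v j t) \<le> (1 - exp (- K * h) / 2 * q ^ \<gamma>) * D"
proof (rule norm_le_if_inner_le)
  fix u :: 'a assume u: "norm u = 1"
  have diam_u: "v i r \<bullet> u - v j t \<bullet> u \<le> D"
    if "i \<in> I" "j \<in> I" "r \<in> {s - \<tau>..s}" "t \<in> {s - \<tau>..s}" for i j r t
    using inner_le_norm_unit[OF diam[OF that] u] by (simp add: inner_diff_left)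
  have "v i r \<bullet> u - v j t \<bullet> u \<le> (1 - exp (- K * h) / 2 * q ^ \<gamma>) * D"
    using delayed_averaging.diameter_contraction[OF proj \<open>0 \<le> s\<close> diam_u R w \<alpha> \<alpha>_int \<kappa> T q l paths ij r t] .
  then show "(v i r - v j t) \<bullet> u \<le> (1 - exp (- K * h) / 2 * q ^ \<gamma>) * D" by (simp add: inner_diff_left)
qed

end

section \<open>Projections of the flocking system\<close>

lemma solution_projection:
  fixes x v :: "nat \<Rightarrow> real \<Rightarrow> real ^ 'd"
  assumes "N \<ge> 2" "\<tau> > 0"
    and delay: "\<And>i j t. i \<in> {1..N} \<Longrightarrow> j \<in> {1..N} \<Longrightarrow> t \<ge> 0 \<Longrightarrow> 0 \<le> \<tau>d i j t \<and> \<tau>d i j t \<le> \<tau>"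
    and \<psi>: "\<And>r. \<psi> r > 0" "\<And>r. \<psi> r \<le> K"
    and \<alpha>: "\<And>i j t. i \<in> {1..N} \<Longrightarrow> j \<in> {1..N} \<Longrightarrow> t \<ge> 0 \<Longrightarrow> 0 \<le> \<alpha> i j t \<and> \<alpha> i j t \<le> 1"
    and sol: "is_solution N G \<tau> \<psi> \<tau>d \<alpha> x0 v0 x v"
  shows "delayed_averaging {1..N} (\<lambda>i j t. adj_coeff G i j * \<alpha> i j t * comm_weight N \<psi> \<tau>d x i j t)
    \<tau>d \<tau> K (\<lambda>i t. v i t \<bullet> u)"
proof
  have cw: "0 \<le> comm_weight N \<psi> \<tau>d x i j t \<and> comm_weight N \<psi> \<tau>d x i j t \<le> 1 / (real N - 1) * K" for i j t
    using \<open>N \<ge> 2\<close> \<psi> by (auto simp: comm_weight_def less_imp_le intro!: divide_right_mono)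
  have bl: "bounded_linear (\<lambda>z. z \<bullet> u)" by (rule bounded_linear_inner_left)
  show "0 \<le> K" using \<psi>[of 0] by linarith
  fix i assume i: "i \<in> {1..N}"
  have s: "continuous_on {-\<tau>..} (v i)" "locally_abs_continuous_on {0..} (v i)"
    "AE t in lebesgue. t > 0 \<longrightarrow>
           (x i has_vector_derivative v i t) (at t) \<and>
           (v i has_vector_derivative
              (\<Sum>j\<in>{1..N} - {i}.
                 (adj_coeff G i j * \<alpha> i j t * comm_weight N \<psi> \<tau>d x i j t) *\<^sub>R
                   (v j (t - \<tau>d i j t) - v i t))) (at t)"
    using sol i unfolding is_solution_def by blast+
  show "continuous_on {-\<tau>..} (\<lambda>t. v i t \<bullet> u)" using s(1) by (intro continuous_intros)
  show "locally_abs_continuous_on {0..} (\<lambda>t. v i t \<bullet> u)"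
    using s(2) abs_continuous_on_bounded_linear[OF bl] by (simp add: locally_abs_continuous_on_def)
  show "AE t in lebesgue. t > 0 \<longrightarrow> ((\<lambda>t. v i t \<bullet> u) has_real_derivative
      (\<Sum>j\<in>{1..N} - {i}. adj_coeff G i j * \<alpha> i j t * comm_weight N \<psi> \<tau>d x i j t *
        (v j (t - \<tau>d i j t) \<bullet> u - v i t \<bullet> u))) (at t)"
    using s(3)
  proof eventually_elim
    case (elim t)
    show ?case
    proof
      assume "t > 0"
      with elim have "(v i has_vector_derivative
              (\<Sum>j\<in>{1..N} - {i}.
                 (adj_coeff G i j * \<alpha> i j t * comm_weight N \<psi> \<tau>d x i j t) *\<^sub>R
                   (v j (t - \<tau>d i j t) - v i t))) (at t)" by blast
      from bounded_linear.has_vector_derivative[OF bl this]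
      show "((\<lambda>t. v i t \<bullet> u) has_real_derivative
        (\<Sum>j\<in>{1..N} - {i}. adj_coeff G i j * \<alpha> i j t * comm_weight N \<psi> \<tau>d x i j t *
          (v j (t - \<tau>d i j t) \<bullet> u - v i t \<bullet> u))) (at t)"
        by (simp add: has_real_derivative_iff_has_vector_derivative inner_sum_left inner_diff_left)
    qed
  qed
  show "0 \<le> adj_coeff G i j * \<alpha> i j t * comm_weight N \<psi> \<tau>d x i j t" if "j \<in> {1..N}" "0 \<le> t" for j t
    using \<alpha>[OF i that] cw by (auto simp: adj_coeff_def)
  show "(\<Sum>j\<in>{1..N} - {i}. adj_coeff G i j * \<alpha> i j t * comm_weight N \<psi> \<tau>d x i j t) \<le> K" if "0 \<le> t" for t
  proof -
    have "adj_coeff G i j * \<alpha> i j t * comm_weight N \<psi> \<tau>d x i j t \<le> 1 / (real N - 1) * K" if "j \<in> {1..N}" for j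
    proof -
      have "adj_coeff G i j * \<alpha> i j t \<le> 1" using \<alpha>[OF i that \<open>0 \<le> t\<close>] by (simp add: adj_coeff_def)
      then have "adj_coeff G i j * \<alpha> i j t * comm_weight N \<psi> \<tau>d x i j t \<le> 1 * comm_weight N \<psi> \<tau>d x i j t"
        using cw by (intro mult_right_mono) auto
      then show ?thesis using cw[of i j t] by linarith
    qed
    \<comment> \<open>The normalisation \<open>1 / (real N - 1)\<close> matches the number of other
      agents, so the total weight is bounded by the bound \<open>K\<close> of \<open>\<psi>\<close>
      itself, independently of \<open>N\<close>.\<close>
    then have "(\<Sum>j\<in>{1..N} - {i}. adj_coeff G i j * \<alpha> i j t * comm_weight N \<psi> \<tau>d x i j t)
        \<le> real (card ({1..N} - {i})) * (1 / (real N - 1) * K)"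
      by (intro sum_bounded_above) auto
    also have "\<dots> = K" using i \<open>N \<ge> 2\<close> by (simp add: of_nat_diff)
    finally show ?thesis .
  qed
qed (use assms(2) delay in auto)

section \<open>Positions recovered from velocities\<close>

lemma solution_velocity_has_integral:
  assumes sol: "is_solution N G \<tau> \<psi> \<tau>d \<alpha> x0 v0 x v" and "i \<in> {1..N}" "0 \<le> s" "s \<le> t"
  shows "(v i has_integral (x i t - x i s)) {s..t}"
proof (rule abs_continuous_has_integral_derivative[OF \<open>s \<le> t\<close>])
  show "abs_continuous_on_interval s t (x i)"
    using assms unfolding is_solution_def locally_abs_continuous_on_def by auto
  have "AE r in lebesgue. r > 0 \<longrightarrow> (x i has_vector_derivative v i r) (at r) \<and>
           (v i has_vector_derivative
              (\<Sum>j\<in>{1..N} - {i}.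
                 (adj_coeff G i j * \<alpha> i j r * comm_weight N \<psi> \<tau>d x i j r) *\<^sub>R
                   (v j (r - \<tau>d i j r) - v i r))) (at r)"
    using assms(1,2) unfolding is_solution_def by blast
  then show "AE r in lebesgue. s < r \<and> r < t \<longrightarrow> (x i has_vector_derivative v i r) (at r)"
    by eventually_elim (use \<open>0 \<le> s\<close> in auto)
qed

lemma norm_position_diff_le:
  assumes sol: "is_solution N G \<tau> \<psi> \<tau>d \<alpha> x0 v0 x v" and ij: "i \<in> {1..N}" "j \<in> {1..N}" and st: "0 \<le> s" "s \<le> t"
    and D: "\<And>r. r \<in> {s..t} \<Longrightarrow> norm (v i r - v j r) \<le> D"
  shows "norm (x i t - x j t) \<le> norm (x i s - x j s) + D * (t - s)"
proof -
  have "((\<lambda>r. v i r - v j r) has_integral (x i t - x i s) - (x j t - x j s)) {s..t}"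
    using ij st by (intro has_integral_diff solution_velocity_has_integral[OF sol])
  moreover have "0 \<le> D" using order_trans[OF norm_ge_zero D[of s]] st by simp
  ultimately have "norm ((x i t - x i s) - (x j t - x j s)) \<le> D * (t - s)"
    using has_integral_bound_real[OF \<open>0 \<le> D\<close> finite.emptyI, of _ "(x i t - x i s) - (x j t - x j s)" s t] D st
    by simp
  moreover have "x i t - x j t = (x i s - x j s) + ((x i t - x i s) - (x j t - x j s))" by simp
  then have "norm (x i t - x j t) \<le> norm (x i s - x j s) + norm ((x i t - x i s) - (x j t - x j s))"
    by (metis norm_triangle_ineq)
  ultimately show ?thesis by linarith
qed

lemma norm_position_increment_le:
  assumes sol: "is_solution N G \<tau> \<psi> \<tau>d \<alpha> x0 v0 x v" and i: "i \<in> {1..N}" and st: "0 \<le> s" "s \<le> t"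
    and V: "\<And>r. r \<in> {s..t} \<Longrightarrow> norm (v i r) \<le> V"
  shows "norm (x i t - x i s) \<le> V * (t - s)"
proof -
  have "0 \<le> V" using order_trans[OF norm_ge_zero V[of s]] st by simp
  then show ?thesis
    using has_integral_bound_real[OF \<open>0 \<le> V\<close> finite.emptyI solution_velocity_has_integral[OF sol i st]] V st
    by simp
qed

section \<open>Diameters and compact time windows\<close>

lemma agent_diam_le_iff:
  assumes "N \<ge> 1"
  shows "agent_diam N z t \<le> c \<longleftrightarrow> (\<forall>i\<in>{1..N}. \<forall>j\<in>{1..N}. norm (z i t - z j t) \<le> c)"
  unfolding agent_diam_def using assms by (subst Max_le_iff) auto

text \<open>Continuity on the compact square makes the family bounded above, which is what turns the
  conditionally complete \<open>SUP\<close> into a genuine upper bound.\<close>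

lemma norm_diff_le_init_diam:
  assumes cont: "\<And>i. i \<in> {1..N} \<Longrightarrow> continuous_on {-\<tau>..0} (z i)"
    and ij: "i \<in> {1..N}" "j \<in> {1..N}" and rs: "r \<in> {-\<tau>..0}" "s \<in> {-\<tau>..0}"
  shows "norm (z i r - z j s) \<le> init_diam N \<tau> z"
proof -
  define S where "S = (\<lambda>(i, j). SUP (r, s) \<in> {-\<tau>..0} \<times> {-\<tau>..0}. norm (z i r - z j s))"
  have "continuous_on ({-\<tau>..0} \<times> {-\<tau>..0}) (\<lambda>(r, s). norm (z i r - z j s))"
    unfolding case_prod_beta
    by (intro continuous_intros continuous_on_compose2[OF cont[OF ij(1)] continuous_on_fst]
        continuous_on_compose2[OF cont[OF ij(2)] continuous_on_snd]) auto
  then have "bdd_above ((\<lambda>(r, s). norm (z i r - z j s)) ` ({-\<tau>..0} \<times> {-\<tau>..0}))"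
    by (intro bounded_imp_bdd_above compact_imp_bounded compact_continuous_image compact_Times) auto
  from cSUP_upper[OF _ this, of "(r, s)"] have "norm (z i r - z j s) \<le> S (i, j)"
    unfolding S_def using rs by simp
  also have "S (i, j) \<le> init_diam N \<tau> z"
    unfolding init_diam_def S_def using ij by (intro Max_ge) auto
  finally show ?thesis by simp
qed

lemma bounded_family_on_Icc:
  assumes "finite I" "\<And>i. i \<in> I \<Longrightarrow> continuous_on {a..b::real} (z i)"
  shows "\<exists>B\<ge>0. \<forall>i\<in>I. \<forall>t\<in>{a..b}. norm (z i t) \<le> B"
proof -
  have "bounded (\<Union>i\<in>I. z i ` {a..b})"
    using assms by (intro bounded_UN ballI compact_imp_bounded compact_continuous_image) auto
  then obtain B where B: "\<And>y. y \<in> (\<Union>i\<in>I. z i ` {a..b}) \<Longrightarrow> norm y \<le> B" by (meson bounded_iff)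
  have "norm (z i t) \<le> max B 0" if "i \<in> I" "t \<in> {a..b}" for i t
    using B[of "z i t"] that by (meson UN_I imageI max.coboundedI1)
  then show ?thesis by (intro exI[of _ "max B 0"]) simp
qed

theorem theorem3p1:
  fixes N \<gamma> :: nat
    and G :: "nat pair_pre_digraph"
    and \<tau> T \<alpha>0 :: real
    and \<psi> :: "real \<Rightarrow> real"
    and \<tau>d \<alpha> :: "nat \<Rightarrow> nat \<Rightarrow> real \<Rightarrow> real"
    and x0 v0 x v :: "nat \<Rightarrow> real \<Rightarrow> real ^ 'd"
  assumes "N \<ge> 2" and "\<tau> > 0"
    and "\<And>i j. i \<in> {1..N} \<Longrightarrow> j \<in> {1..N} \<Longrightarrow> continuous_on {0..} (\<tau>d i j)"
    and "\<And>i j t. i \<in> {1..N} \<Longrightarrow> j \<in> {1..N} \<Longrightarrow> t \<ge> 0 \<Longrightarrow> 0 \<le> \<tau>d i j t \<and> \<tau>d i j t \<le> \<tau>"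
    and "pair_digraph G" and "pverts G = {1..N}"
    and "strongly_connected (with_proj G)"
    and "\<gamma> = graph_depth G"
    and "\<And>r. \<psi> r > 0" and "bounded (range \<psi>)" and "continuous_on UNIV \<psi>"
    and "(\<integral>\<^sup>+t\<in>{0..}. ennreal ((INF r\<in>{0..t}. \<psi> r) ^ \<gamma>) \<partial>lebesgue) = \<infinity>"
    and "\<And>i j. i \<in> {1..N} \<Longrightarrow> j \<in> {1..N} \<Longrightarrow> \<alpha> i j \<in> borel_measurable (lebesgue_on {0..})"
    and "\<And>i j t. i \<in> {1..N} \<Longrightarrow> j \<in> {1..N} \<Longrightarrow> t \<ge> 0 \<Longrightarrow> 0 \<le> \<alpha> i j t \<and> \<alpha> i j t \<le> 1"
    and "T > 0" and "\<alpha>0 > 0"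
    and "\<And>i j t. i \<in> {1..N} \<Longrightarrow> j \<in> {1..N} \<Longrightarrow> adj_coeff G i j = 1 \<Longrightarrow> t \<ge> 0 \<Longrightarrow>
           (LINT s:{t..t + T}|lebesgue. \<alpha> i j s) \<ge> \<alpha>0"
    and "\<And>i. i \<in> {1..N} \<Longrightarrow> continuous_on {-\<tau>..0} (x0 i) \<and> continuous_on {-\<tau>..0} (v0 i)"
    and "is_solution N G \<tau> \<psi> \<tau>d \<alpha> x0 v0 x v"
  shows "(\<exists>dstar>0. (SUP t\<in>{-\<tau>..}. ereal (agent_diam N x t)) \<le> ereal dstar) \<and>
         (\<exists>\<mu>>0. \<forall>t\<ge>0. agent_diam N v t
             \<le> init_diam N \<tau> v * exp (- \<mu> * (t - real \<gamma> * (T + \<tau>) - \<tau>)))"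
proof -
  note N = assms(1) and \<tau> = assms(2) and delay = assms(4) and \<psi>_pos = assms(9) and \<alpha>_bd = assms(14)
    and sol = assms(19)
  let ?I = "{1..N}"
  obtain K where K: "\<And>r. \<psi> r \<le> K"
    using assms(10) unfolding bounded_iff by (metis abs_le_D1 rangeI real_norm_def)
  have "K > 0" using \<psi>_pos[of 0] K[of 0] by linarith
  define W where "W i j t = adj_coeff G i j * \<alpha> i j t * comm_weight N \<psi> \<tau>d x i j t" for i j t
  have proj: "delayed_averaging ?I W \<tau>d \<tau> K (\<lambda>i t. v i t \<bullet> u)" for u
    unfolding W_def by (rule solution_projection[OF N \<tau> delay \<psi>_pos K \<alpha>_bd sol])

  \<comment> \<open>Running minimum of the influence function\<close>
  define m where "m t = (INF r\<in>{0..t}. \<psi> r)" for t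
  have m_le: "m t \<le> \<psi> r" if "0 \<le> r" "r \<le> t" for r t
    unfolding m_def using that \<psi>_pos
    by (intro cINF_lower bdd_belowI2[of _ 0]) (auto intro: less_imp_le)
  have m_pos: "0 < m t" if t: "0 \<le> t" for t
  proof -
    obtain r where "\<forall>s\<in>{0..t}. \<psi> r \<le> \<psi> s"
      using continuous_attains_inf[of "{0..t}" \<psi>] t continuous_on_subset[OF assms(11)] by auto
    then have "\<psi> r \<le> m t" unfolding m_def using t by (intro cINF_greatest) auto
    then show ?thesis using \<psi>_pos[of r] by linarith
  qed
  have m_anti: "m t \<le> m s" if "0 \<le> s" "s \<le> t" for s t
    unfolding m_def[of s] using that m_le[of _ t] by (intro cINF_greatest) auto
  have m_le_K: "m t \<le> K" if "0 \<le> t" for t using m_le[of 0 t] K[of 0] that by simp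

  \<comment> \<open>Bounds on initial data, speeds and delayed positions\<close>
  have cont: "continuous_on {-\<tau>..0} (x i)" "continuous_on {-\<tau>..0} (v i)" if "i \<in> ?I" for i
  proof -
    have "continuous_on {-\<tau>..} (x i)" "continuous_on {-\<tau>..} (v i)"
      using sol that unfolding is_solution_def by blast+
    then show "continuous_on {-\<tau>..0} (x i)" "continuous_on {-\<tau>..0} (v i)"
      by (auto elim: continuous_on_subset)
  qed
  have "\<exists>X\<ge>0. \<forall>i\<in>?I. \<forall>t\<in>{-\<tau>..0}. norm (x i t) \<le> X" using cont(1)
    by (intro bounded_family_on_Icc) auto
  then obtain X where "0 \<le> X" and X: "\<And>i t. i \<in> ?I \<Longrightarrow> t \<in> {-\<tau>..0} \<Longrightarrow> norm (x i t) \<le> X" by blast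
  have "\<exists>V\<ge>0. \<forall>i\<in>?I. \<forall>t\<in>{-\<tau>..0}. norm (v i t) \<le> V" using cont(2)
    by (intro bounded_family_on_Icc) auto
  then obtain V where "0 \<le> V" and V0: "\<And>i t. i \<in> ?I \<Longrightarrow> t \<in> {-\<tau>..0} \<Longrightarrow> norm (v i t) \<le> V" by blast
  have V: "norm (v i t) \<le> V" if "i \<in> ?I" "- \<tau> \<le> t" for i t
    by (rule norm_bound_invariant[OF proj _ that]) (use V0 in simp)
  have X2: "norm (x i r - x j s) \<le> 2 * X" if "i \<in> ?I" "j \<in> ?I" "r \<in> {-\<tau>..0}" "s \<in> {-\<tau>..0}" for i j r s
    using norm_triangle_ineq4[of "x i r" "x j s"] X[OF that(1,3)] X[OF that(2,4)] by linarith
  \<comment> \<open>Over a delay within nonnegative time a position moves by at most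
    \<open>V * \<tau>\<close>. A delayed time before 0 falls into the initial data, where positions
    need not follow velocities, so \<open>2 * X\<close> is added.\<close>
  define L where "L = 2 * X + V * \<tau>"
  have "0 \<le> L" using \<open>0 \<le> X\<close> \<open>0 \<le> V\<close> \<tau> by (simp add: L_def)
  have lag: "norm (x i t - x i (t - \<delta>)) \<le> L" if i: "i \<in> ?I" and t: "0 \<le> t" "0 \<le> \<delta>" "\<delta> \<le> \<tau>" for i t \<delta>
  proof (cases "\<delta> \<le> t")
    case True
    have "norm (x i t - x i (t - \<delta>)) \<le> V * (t - (t - \<delta>))"
      using True t by (intro norm_position_increment_le[OF sol i] V[OF i]) auto
    also have "\<dots> \<le> V * \<tau>" using t \<open>0 \<le> V\<close> by (simp add: mult_left_mono)
    finally show ?thesis using \<open>0 \<le> X\<close> by (simp add: L_def)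
  next
    case False
    have "norm (x i t - x i 0) \<le> V * (t - 0)"
      using t \<tau> by (intro norm_position_increment_le[OF sol i] V[OF i]) auto
    also have "\<dots> \<le> V * \<tau>" using False t \<open>0 \<le> V\<close> by (intro mult_left_mono) auto
    finally have "norm (x i t - x i 0) \<le> V * \<tau>" .
    moreover have "norm (x i 0 - x i (t - \<delta>)) \<le> 2 * X" using False t \<tau> by (intro X2 i) auto
    ultimately show ?thesis
      using norm_triangle_ineq[of "x i t - x i 0" "x i 0 - x i (t - \<delta>)"] by (simp add: L_def)
  qed

  define h where "h = real \<gamma> * (T + \<tau>) + \<tau>"
  have "0 \<le> real \<gamma> * (T + \<tau>)" using assms(15) \<tau> by simp
  then have "0 < h" using \<tau> by (simp add: h_def)

  \<comment> \<open>Excitation, paths and constants of the contraction\<close>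
  interpret G: pair_digraph G by (rule assms(5))
  have arcs: "i \<in> ?I \<and> j \<in> ?I \<and> i \<noteq> j" if "(i, j) \<in> parcs G" for i j
    using G.arc_fst_in_verts[OF that] G.arc_snd_in_verts[OF that] G.pair_no_loops[OF that] assms(6)
    by simp
  have \<alpha>_nonneg: "0 \<le> \<alpha> i j t" if "(i, j) \<in> parcs G" "0 \<le> t" for i j t
    using arcs[OF that(1)] \<alpha>_bd that(2) by blast
  have \<alpha>_int: "\<alpha> i j integrable_on {t..t + T} \<and> \<alpha>0 \<le> integral {t..t + T} (\<alpha> i j)"
    if ij: "(i, j) \<in> parcs G" and "0 \<le> t" for i j t
  proof -
    have I: "i \<in> ?I" "j \<in> ?I" using arcs[OF ij] by auto
    \<comment> \<open>Measurability and the bound 1 give integrability, which identifies the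
      Lebesgue integral of the excitation condition with the gauge integral used in the
      estimates.\<close>
    have "\<alpha> i j \<in> borel_measurable (lebesgue_on {t..t + T})"
      by (rule measurable_restrict_mono[OF assms(13)[OF I]]) (use \<open>0 \<le> t\<close> in auto)
    then have abs_int: "\<alpha> i j absolutely_integrable_on {t..t + T}"
    proof (rule measurable_bounded_by_integrable_imp_absolutely_integrable[where g = "\<lambda>_. 1"])
      show "norm (\<alpha> i j s) \<le> 1" if "s \<in> {t..t + T}" for s
        using \<alpha>_bd[OF I, of s] that \<open>0 \<le> t\<close> by simp
    qed auto
    have "adj_coeff G i j = 1" using ij by (simp add: adj_coeff_def)
    then show ?thesis
      using assms(17)[OF I _ \<open>0 \<le> t\<close>] set_lebesgue_integral_eq_integral[OF abs_int] by simp
  qed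
  \<comment> \<open>Agent 1 is an arbitrary choice of root; strong connectivity provides paths to
    any vertex.\<close>
  have paths: "\<exists>k\<le>\<gamma>. (i, 1) \<in> parcs G ^^ k" if "i \<in> ?I" for i
    using relpow_le_graph_depth[OF assms(5,7)] that N assms(6,8) by simp

  \<comment> \<open>The factor per arc will be \<open>q = \<beta> * m t\<close>. The first entry of
    the minimum gives the bound on \<open>q\<close> required for
    \<open>\<kappa> = m t / (real N - 1)\<close>; the second gives \<open>q \<le> 1\<close>, since
    \<open>m t \<le> K\<close>.\<close>
  define \<beta> where "\<beta> = min (exp (- K * T) / (real N - 1) * \<alpha>0) (1 / K)"
  have "0 < \<beta>" using \<open>0 < K\<close> N assms(16) by (auto simp: \<beta>_def)
  have \<beta>m: "0 \<le> \<beta> * m t" "\<beta> * m t \<le> exp (- K * T) * (m t / (real N - 1)) * \<alpha>0" "\<beta> * m t \<le> 1"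
    if "0 \<le> t" for t
  proof -
    show "0 \<le> \<beta> * m t" using \<open>0 < \<beta>\<close> m_pos[OF that] by simp
    have "\<beta> * m t \<le> exp (- K * T) / (real N - 1) * \<alpha>0 * m t"
      using m_pos[OF that] by (intro mult_right_mono) (auto simp: \<beta>_def)
    then show "\<beta> * m t \<le> exp (- K * T) * (m t / (real N - 1)) * \<alpha>0" by (simp add: mult_ac)
    have "\<beta> * m t \<le> 1 / K * K"
      using m_pos[OF that] m_le_K[OF that] \<open>0 < K\<close> by (intro mult_mono) (auto simp: \<beta>_def)
    then show "\<beta> * m t \<le> 1" using \<open>0 < K\<close> by simp
  qed
  define c where "c = exp (- K * h) / 2 * \<beta> ^ \<gamma>"
  have "0 < c" using \<open>0 < \<beta>\<close> by (simp add: c_def)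
  have c_m: "c * m t ^ \<gamma> = exp (- K * h) / 2 * (\<beta> * m t) ^ \<gamma>" for t
    by (simp add: c_def power_mult_distrib)
  have c_small: "c * m t ^ \<gamma> \<le> 1 / 2" if "0 \<le> t" for t
  proof -
    have "exp (- K * h) * (\<beta> * m t) ^ \<gamma> \<le> 1 * 1"
      using \<beta>m[OF that] \<open>0 < K\<close> \<open>0 < h\<close> by (intro mult_mono power_le_one) auto
    then show ?thesis by (simp add: c_m)
  qed

  \<comment> \<open>The comparison recursion\<close>
  define D0 where "D0 = init_diam N \<tau> v"
  have D0: "norm (v i r - v j s) \<le> D0" if "i \<in> ?I" "j \<in> ?I" "r \<in> {-\<tau>..0}" "s \<in> {-\<tau>..0}" for i j r s
    unfolding D0_def using cont(2) that by (rule norm_diff_le_init_diam)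
  have "0 \<le> D0" using D0[of 1 1 0 0] N \<tau> by simp
  \<comment> \<open>A worst-case evolution: \<open>y\<close> bounds distances including the lag
    \<open>L\<close>, \<open>D\<close> bounds the velocity diameter. The distance is updated with
    the old \<open>D\<close>, and the contraction is then evaluated at the new distance. The start
    \<open>2 * X + L\<close> covers the distances at time 0.\<close>
  define yD where "yD = rec_nat (2 * X + L, D0) (\<lambda>_ (y, D). (y + h * D, (1 - c * m (y + h * D) ^ \<gamma>) * D))"
  define y D where "y n = fst (yD n)" and "D n = snd (yD n)" for n
  have y_0: "y 0 = 2 * X + L" and D_0: "D 0 = D0" by (simp_all add: y_def D_def yD_def)
  have y_Suc: "y (Suc n) = y n + h * D n"
    and D_Suc: "D (Suc n) = (1 - c * m (y (Suc n)) ^ \<gamma>) * D n" for n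
    by (simp_all add: y_def D_def yD_def case_prod_beta)
  have "0 \<le> y 0" using \<open>0 \<le> X\<close> \<open>0 \<le> L\<close> by (simp add: y_0)
  have "0 \<le> D 0" using \<open>0 \<le> D0\<close> by (simp add: D_0)
  have "m t ^ \<gamma> \<le> m s ^ \<gamma>" if "0 \<le> s" "s \<le> t" for s t
    using m_anti[OF that] m_pos[of t] that by (intro power_mono) auto
  note bootstrap = bootstrap_decay[of "\<lambda>t. m t ^ \<gamma>" c h y D, OF this _ c_small \<open>0 < h\<close> \<open>0 < c\<close> \<open>0 \<le> y 0\<close>
      \<open>0 \<le> D 0\<close> y_Suc D_Suc assms(12)[folded m_def]]
  obtain Y where Y: "y n \<le> Y" for n using bootstrap(1) m_pos by (auto simp: zero_less_power)
  obtain \<mu> where "0 < \<mu>" and \<mu>: "D n \<le> D 0 * exp (- \<mu> * (real n * h))" for n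
    using bootstrap(2) m_pos by (auto simp: zero_less_power)

  \<comment> \<open>Domination of the solution by the recursion\<close>
  have inv: "0 \<le> D n \<and> 0 \<le> y n \<and>
      (\<forall>i\<in>?I. \<forall>j\<in>?I. \<forall>r\<ge>real n * h - \<tau>. \<forall>t\<ge>real n * h - \<tau>. norm (v i r - v j t) \<le> D n) \<and>
      (\<forall>i\<in>?I. \<forall>j\<in>?I. \<forall>t\<in>{0..real n * h}. norm (x i t - x j t) + L \<le> y n)" for n
  proof (induction n)
    case 0
    have "norm (v i r - v j t) \<le> D 0" if "i \<in> ?I" "j \<in> ?I" "- \<tau> \<le> r" "- \<tau> \<le> t" for i j r t
      using norm_diameter_invariant[OF proj, of 0 D0 i j r t] D0 that by (simp add: D_0)
    then show ?case using X2[of _ _ 0 0] \<tau> \<open>0 \<le> y 0\<close> \<open>0 \<le> D 0\<close> by (auto simp: y_0)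
  next
    case (Suc n)
    define s where "s = real n * h"
    have s': "real (Suc n) * h = s + h" by (simp add: s_def algebra_simps)
    have "0 \<le> s" using \<open>0 < h\<close> by (simp add: s_def)
    have Dn: "0 \<le> D n" "0 \<le> y n" using Suc by auto
    have vel: "norm (v i r - v j t) \<le> D n" if "i \<in> ?I" "j \<in> ?I" "s - \<tau> \<le> r" "s - \<tau> \<le> t" for i j r t
      using Suc that unfolding s_def by blast
    have pos: "norm (x i t - x j t) + L \<le> y n" if "i \<in> ?I" "j \<in> ?I" "0 \<le> t" "t \<le> s" for i j t
      using Suc that unfolding s_def by auto
    have ySuc: "0 \<le> y (Suc n)" using Dn \<open>0 < h\<close> by (simp add: y_Suc)
    \<comment> \<open>The growth of distances uses only the velocity bound \<open>D n\<close> known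
      at the start of the period. Hence \<open>y (Suc n)\<close> controls the weights on
      \<open>[s, s + h]\<close> before any contraction in that period is shown.\<close>
    have pos': "norm (x i t - x j t) + L \<le> y (Suc n)" if "i \<in> ?I" "j \<in> ?I" "0 \<le> t" "t \<le> s + h" for i j t
    proof (cases "t \<le> s")
      case True
      have "0 \<le> h * D n" using Dn \<open>0 < h\<close> by simp
      then show ?thesis using pos[OF that(1-3) True] by (simp add: y_Suc)
    next
      case False
      have "norm (x i t - x j t) \<le> norm (x i s - x j s) + D n * (t - s)"
        using that False \<open>0 \<le> s\<close> \<tau> by (intro norm_position_diff_le[OF sol] vel) auto
      also have "D n * (t - s) \<le> D n * h" using Dn that False by (intro mult_left_mono) auto
      finally show ?thesis using pos[OF that(1,2) \<open>0 \<le> s\<close>] by (simp add: y_Suc mult.commute)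
    qed
    have w: "m (y (Suc n)) / (real N - 1) * \<alpha> i j t \<le> W i j t"
      if ij: "(i, j) \<in> parcs G" and t: "s \<le> t" "t \<le> s + h" for i j t
    proof -
      have I: "i \<in> ?I" "j \<in> ?I" using arcs[OF ij] by auto
      have "0 \<le> t" using t \<open>0 \<le> s\<close> by simp
      have "norm (x i t - x j (t - \<tau>d i j t)) \<le> norm (x i t - x j t) + norm (x j t - x j (t - \<tau>d i j t))"
        using norm_triangle_ineq[of "x i t - x j t" "x j t - x j (t - \<tau>d i j t)"] by simp
      also have "\<dots> \<le> norm (x i t - x j t) + L"
        using lag[OF I(2) \<open>0 \<le> t\<close>] delay[OF I \<open>0 \<le> t\<close>] by auto
      also have "\<dots> \<le> y (Suc n)" using pos'[OF I \<open>0 \<le> t\<close> t(2)] .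
      finally have "m (y (Suc n)) \<le> \<psi> (norm (x i t - x j (t - \<tau>d i j t)))" by (intro m_le) auto
      then have "m (y (Suc n)) / (real N - 1) \<le> comm_weight N \<psi> \<tau>d x i j t"
        using N by (simp add: comm_weight_def divide_right_mono)
      then have "m (y (Suc n)) / (real N - 1) * \<alpha> i j t \<le> comm_weight N \<psi> \<tau>d x i j t * \<alpha> i j t"
        using \<alpha>_nonneg[OF ij \<open>0 \<le> t\<close>] by (rule mult_right_mono)
      then show ?thesis using ij by (simp add: W_def adj_coeff_def mult.commute)
    qed
    have "norm (v i r - v j t) \<le> D (Suc n)"
      if "i \<in> ?I" "j \<in> ?I" "r \<in> {s + h - \<tau>..s + h}" "t \<in> {s + h - \<tau>..s + h}" for i j r t
    proof -
      \<comment> \<open>Used with \<open>\<kappa> = m (y (Suc n)) / (real N - 1)\<close> and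
        \<open>q = \<beta> * m (y (Suc n))\<close>. Since \<open>h\<close> exceeds
        \<open>real \<gamma> * (T + \<tau>)\<close> by \<open>\<tau>\<close>, the contracted bound
        holds on the whole window ending at \<open>s + h\<close>.\<close>
      have "norm (v i r - v j t) \<le> (1 - exp (- K * h) / 2 * (\<beta> * m (y (Suc n))) ^ \<gamma>) * D n"
      proof (rule norm_diameter_contraction[OF proj \<open>0 \<le> s\<close> vel arcs w \<alpha>_nonneg \<alpha>_int _ _ \<beta>m[OF ySuc] _ paths])
        show "s + real \<gamma> * (T + \<tau>) \<le> r" "s + real \<gamma> * (T + \<tau>) \<le> t" using that by (auto simp: h_def)
      qed (use that N assms(15) m_pos[OF ySuc] in auto)
      then show ?thesis by (simp add: D_Suc c_m)
    qed
    then have "norm (v i r - v j t) \<le> D (Suc n)"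
      if "i \<in> ?I" "j \<in> ?I" "s + h - \<tau> \<le> r" "s + h - \<tau> \<le> t" for i j r t
      using norm_diameter_invariant[OF proj, of "s + h" "D (Suc n)" i j r t] that \<open>0 \<le> s\<close> \<open>0 < h\<close> by simp
    moreover have "0 \<le> D (Suc n)" using c_small[OF ySuc] Dn by (simp add: D_Suc)
    ultimately show ?case unfolding s' using ySuc pos' by simp
  qed

  \<comment> \<open>Bounded positions and exponential decay of velocities\<close>
  have "agent_diam N x t \<le> Y" if "-\<tau> \<le> t" for t
  proof -
    have "norm (x i t - x j t) \<le> Y" if ij: "i \<in> ?I" "j \<in> ?I" for i j
    proof (cases "0 \<le> t")
      case True
      obtain n :: nat where "t / h \<le> real n" using real_arch_simple by blast
      then have "t \<le> real n * h" using \<open>0 < h\<close> by (simp add: field_simps)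
      then have "norm (x i t - x j t) + L \<le> y n" using inv[of n] ij True by simp
      then show ?thesis using Y[of n] \<open>0 \<le> L\<close> by linarith
    next
      case False
      then have "norm (x i t - x j t) \<le> 2 * X" using X2[OF ij, of t t] \<open>-\<tau> \<le> t\<close> by simp
      then show ?thesis using Y[of 0] \<open>0 \<le> L\<close> by (simp add: y_0)
    qed
    then show ?thesis using N by (simp add: agent_diam_le_iff)
  qed
  \<comment> \<open>\<open>Y\<close> may be 0; adding 1 makes the bound strictly positive.\<close>
  then have "(SUP t\<in>{-\<tau>..}. ereal (agent_diam N x t)) \<le> ereal (Y + 1)"
    by (intro SUP_least) (simp add: add_increasing2)
  moreover have "0 < Y + 1" using Y[of 0] \<open>0 \<le> y 0\<close> by linarith
  moreover have "agent_diam N v t \<le> init_diam N \<tau> v * exp (- \<mu> * (t - real \<gamma> * (T + \<tau>) - \<tau>))"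
    if "0 \<le> t" for t
  proof -
    \<comment> \<open>The number of completed periods. Rounding down loses at most one period,
      \<open>t - h \<le> real n * h\<close>, and this is the shift by
      \<open>\<gamma> * (T + \<tau>) + \<tau>\<close> in the exponent.\<close>
    define n where "n = nat \<lfloor>t / h\<rfloor>"
    have "real n = of_int \<lfloor>t / h\<rfloor>" using that \<open>0 < h\<close> by (simp add: n_def)
    then have "real n \<le> t / h" "t / h < real n + 1" by linarith+
    then have n: "real n * h \<le> t" "t - h \<le> real n * h" using \<open>0 < h\<close> by (auto simp: field_simps)
    have "agent_diam N v t \<le> D n"
      using inv[of n] n(1) \<tau> N by (simp add: agent_diam_le_iff)
    also have "\<dots> \<le> D 0 * exp (- \<mu> * (real n * h))" by (rule \<mu>)
    also have "\<dots> \<le> D 0 * exp (- \<mu> * (t - h))"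
      using n(2) \<open>0 < \<mu>\<close> \<open>0 \<le> D 0\<close> by (intro mult_left_mono) auto
    finally show ?thesis by (simp add: D_0 D0_def h_def algebra_simps)
  qed
  ultimately show ?thesis using \<open>0 < \<mu>\<close> by blast
qed

end
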